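(* Let $X$ be a random variable with values in $[0,1)$, let $\mu=\mathbf{E}\{-\log X\}\in(0,+\infty]$ and $\sigma^2=\mathbf{Var}\{-\log X\}$, and let $D_n$ be the depth of node $n$ in a scaled attachment random recursive tree with attachment $X$. Then, as $n\to\infty$: (A) If $\mu=+\infty$, then $\dfrac{D_n}{\log n}\to 0$ in probability and $\lim_{n\to\infty}\dfrac{\mathbf{E}\{D_n\}}{\log n}=0$. (B) If $\mu<+\infty$, then $\dfrac{D_n}{\log n}\to\dfrac1\mu$ in probability and $\lim_{n\to\infty}\dfrac{\mathbf{E}\{D_n\}}{\log n}=\dfrac1\mu$. (C) If $\mu<+\infty$ and $0<\sigma^2<+\infty$, then $\dfrac{D_n-\log n/\mu}{\sigma\sqrt{\log n/\mu^3}}$ converges in distribution to a standard Gaussian $\mathcal N(0,1)$. (D) If $\mu<+\infty$ and $\sigma^2=0$, then $D_n-\log n/\mu=o\left(\sqrt{\log n}\right)$ almost surely.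
   Context: Scaled attachment random recursive tree (SARRT) with attachment $X$: let $X_0,X_1,X_2,\dots$ be i.i.d. random variables distributed as $X\in[0,1)$. The nodes are labeled $0,1,2,\dots$ (the tree of order $n$ uses nodes $0,\dots,n$); the root is $0$ and the parent of node $i\ge1$ is the node labeled $\lfloor iX_i\rfloor$. Set $L(i,0)=i$ and $L(i,j+1)=\lfloor L(i,j)X_{L(i,j)}\rfloor$. The depth of node $i$ is $D_i=\min\{j\ge0:L(i,j)=0\}$. Conventions: if $X$ has an atom at $0$ then $\mu=\sigma=+\infty$; if $\mu=+\infty$ then $\sigma=+\infty$ by definition. *)

theory Defs
  imports "HOL-Probability.Probability" "HOL-Library.Landau_Symbols"
begin

definition sarrt_parent :: "(nat \<Rightarrow> real) \<Rightarrow> nat \<Rightarrow> nat" where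
  "sarrt_parent x i = nat \<lfloor>real i * x i\<rfloor>"

primrec sarrt_ancestor :: "(nat \<Rightarrow> real) \<Rightarrow> nat \<Rightarrow> nat \<Rightarrow> nat" where
  "sarrt_ancestor x i 0 = i"
| "sarrt_ancestor x i (Suc j) = sarrt_parent x (sarrt_ancestor x i j)"

(* If all x k lie in [0,1), labels strictly decrease along a path until they reach 0, so the
   minimum exists and is at most i. *)
definition sarrt_depth :: "(nat \<Rightarrow> real) \<Rightarrow> nat \<Rightarrow> nat" where
  "sarrt_depth x i = (LEAST j. sarrt_ancestor x i j = 0)"

(* -log on [0,1) with -log 0 = \<infinity>; the case split is needed because ln 0 = 0 for type real. *)
definition neg_log :: "real \<Rightarrow> ennreal" where
  "neg_log x = (if x = 0 then \<infinity> else ennreal (- ln x))"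

definition neg_log_mean :: "'a measure \<Rightarrow> ('a \<Rightarrow> real) \<Rightarrow> ennreal" where
  "neg_log_mean M X = (\<integral>\<^sup>+ \<omega>. neg_log (X \<omega>) \<partial>M)"

(* Extended-valued variance, since the Bochner integral of a non-integrable function is 0.
   In the second branch X = 0 has probability 0, so the value of ln 0 is irrelevant. *)
definition neg_log_variance :: "'a measure \<Rightarrow> ('a \<Rightarrow> real) \<Rightarrow> ennreal" where
  "neg_log_variance M X =
     (if neg_log_mean M X = \<infinity> then \<infinity>
      else (\<integral>\<^sup>+ \<omega>. ennreal ((- ln (X \<omega>) - enn2real (neg_log_mean M X))\<^sup>2) \<partial>M))"

definition tendsto_in_prob :: "'a measure \<Rightarrow> (nat \<Rightarrow> 'a \<Rightarrow> real) \<Rightarrow> real \<Rightarrow> bool" where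
  "tendsto_in_prob M Y c \<longleftrightarrow>
     (\<forall>\<epsilon>>0. (\<lambda>n. measure M {\<omega> \<in> space M. \<bar>Y n \<omega> - c\<bar> > \<epsilon>}) \<longlonglongrightarrow> 0)"

end

theory Submission
  imports Defs "HOL-Real_Asymp.Real_Asymp"
begin

text \<open>The labels on the path from \<open>n\<close> to the root decrease, so the path uses each variable at most
  once and the probabilities \<open>P (D n > m)\<close> satisfy a Markov recursion in \<open>m\<close>, with
  \<open>n\<close> replaced by \<open>\<lfloor>n X\<rfloor>\<close>. All estimates are inductions along this recursion. The bound
  \<open>P (D n > m) \<le> n powr s * (E (X powr s)) ^ m\<close> with \<open>s\<close> tending to \<open>0\<close> controls the upper tail and
  the mean from above, also for infinite \<open>\<mu>\<close>. Comparing \<open>E (D n)\<close> with \<open>ln (n / K) / (\<mu> + 1 / K)\<close>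
  bounds the mean from below, and together these give convergence in mean. For the finer statements,
  let \<open>S m\<close> be the sum of \<open>m\<close> independent copies of \<open>- ln X\<close>; then
  \<open>P (S m < ln (n / K) - m / K) \<le> P (D n > m) \<le> P (S m \<le> ln n)\<close>, because above level \<open>K\<close> each
  rounding costs at most \<open>1 / K\<close> on the logarithmic scale. With \<open>K\<close> about \<open>ln n\<close> the correction is
  \<open>o (sqrt (ln n))\<close>, so the central limit theorem for \<open>S m\<close> transfers to \<open>D n\<close>.\<close>

section \<open>Ancestors and depth\<close>

lemma sarrt_parent_0 [simp]: "sarrt_parent x 0 = 0"
  by (simp add: sarrt_parent_def)

lemma sarrt_parent_less:
  assumes "x i \<in> {0..<1}" "i > 0"
  shows "sarrt_parent x i < i"
proof -
  have "real i * x i < real i" using assms by simp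
  then show ?thesis using assms unfolding sarrt_parent_def
    by (simp add: floor_less_iff nat_less_iff)
qed

text \<open>The definition iterates at the far end of the path; peeling off the first step instead
  gives the recursion of the depth through the parent.\<close>

lemma sarrt_ancestor_Suc_shift:
  "sarrt_ancestor x i (Suc j) = sarrt_ancestor x (sarrt_parent x i) j"
  by (induction j) simp_all

text \<open>Each step from a positive label loses at least one, and truncated subtraction covers a
  path already at the root. Hence \<open>i\<close> steps reach \<open>0\<close>, so the
  \<open>LEAST\<close> in the depth is attained.\<close>

lemma sarrt_ancestor_le:
  assumes "\<And>k. k \<le> i \<Longrightarrow> x k \<in> {0..<1}"
  shows "sarrt_ancestor x i j \<le> i - j"
proof (induction j)
  case (Suc j)
  show ?case
  proof (cases "sarrt_ancestor x i j = 0")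
    case False
    then have "sarrt_parent x (sarrt_ancestor x i j) < sarrt_ancestor x i j"
      using Suc assms by (intro sarrt_parent_less) auto
    with Suc show ?thesis by simp
  qed simp
qed simp

lemma sarrt_depth_0 [simp]: "sarrt_depth x 0 = 0"
  unfolding sarrt_depth_def by (rule Least_equality) auto

lemma sarrt_depth_le:
  assumes "\<And>k. k \<le> i \<Longrightarrow> x k \<in> {0..<1}"
  shows "sarrt_depth x i \<le> i"
  unfolding sarrt_depth_def using sarrt_ancestor_le[where x = x and i = i and j = i, OF assms] by (intro Least_le) auto

lemma sarrt_depth_rec:
  assumes "\<And>k. k \<le> i \<Longrightarrow> x k \<in> {0..<1}" "i > 0"
  shows "sarrt_depth x i = Suc (sarrt_depth x (sarrt_parent x i))"
proof -
  have "sarrt_ancestor x i i = 0" using sarrt_ancestor_le[where x = x and i = i and j = i, OF assms(1)] by simp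
  from Least_Suc[of "\<lambda>j. sarrt_ancestor x i j = 0", OF this] assms(2) show ?thesis
    unfolding sarrt_depth_def by (simp add: sarrt_ancestor_Suc_shift del: sarrt_ancestor.simps(2))
qed

text \<open>The path from \<open>i\<close> never leaves the labels up to \<open>i\<close>, so no
  other coordinate is read. This is what later makes \<open>Y n\<close> independent of the depths of
  smaller nodes.\<close>

lemma sarrt_depth_cong:
  assumes "\<And>k. k \<le> i \<Longrightarrow> x k \<in> {0..<1}" "\<And>k. k \<le> i \<Longrightarrow> x k = y k"
  shows "sarrt_depth x i = sarrt_depth y i"
proof -
  have "sarrt_ancestor x i j = sarrt_ancestor y i j" for j
  proof (induction j)
    case (Suc j)
    have "sarrt_ancestor x i j \<le> i" using sarrt_ancestor_le[where x = x and i = i and j = j, OF assms(1)] by simp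
    then show ?case using Suc assms(2) by (simp add: sarrt_parent_def)
  qed simp
  then show ?thesis by (simp add: sarrt_depth_def)
qed

lemma sarrt_ancestor_measurable:
  assumes [measurable]: "\<And>i. X i \<in> borel_measurable M"
  shows "(\<lambda>\<omega>. sarrt_ancestor (\<lambda>i. X i \<omega>) k j) \<in> measurable M (count_space UNIV)"
proof (induction j)
  case (Suc j)
  have [measurable]: "(\<lambda>\<omega>. sarrt_parent (\<lambda>i. X i \<omega>) i) \<in> measurable M (count_space UNIV)" for i
    unfolding sarrt_parent_def by measurable
  \<comment> \<open>The index of the next variable is random, but takes only countably many
    values.\<close>
  show ?case
    by (simp, rule measurable_compose_countable[OF _ Suc]) measurable
qed simp

lemma sarrt_depth_measurable:
  assumes [measurable]: "\<And>i. X i \<in> borel_measurable M"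
  shows "(\<lambda>\<omega>. sarrt_depth (\<lambda>i. X i \<omega>) k) \<in> measurable M (count_space UNIV)"
proof -
  note [measurable] = sarrt_ancestor_measurable[OF assms]
  show ?thesis unfolding sarrt_depth_def by measurable
qed

section \<open>The Markov recursion\<close>

locale sarrt = prob_space M for M :: "'a measure" +
  fixes Y :: "nat \<Rightarrow> 'a \<Rightarrow> real"
  assumes indep: "indep_vars (\<lambda>_. borel) Y UNIV"
    and range: "Y i \<omega> \<in> {0..<1}"
    and ident: "distr M borel (Y i) = distr M borel (Y 0)"
begin

definition depth :: "nat \<Rightarrow> 'a \<Rightarrow> nat" where
  "depth n \<omega> = sarrt_depth (\<lambda>i. Y i \<omega>) n"

lemma Y_measurable [measurable]: "Y i \<in> borel_measurable M"
  using indep by (auto simp: indep_vars_def)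

lemma Y_nonneg: "0 \<le> Y i \<omega>" and Y_less_1: "Y i \<omega> < 1"
  using range[of i \<omega>] by auto

lemma depth_measurable [measurable]: "depth n \<in> measurable M (count_space UNIV)"
  unfolding depth_def[abs_def] by (rule sarrt_depth_measurable) measurable

lemma depth_le: "depth n \<omega> \<le> n"
  unfolding depth_def using range by (intro sarrt_depth_le) blast

lemma depth_0 [simp]: "depth 0 \<omega> = 0"
  by (simp add: depth_def)

text \<open>The depth of \<open>n\<close> takes at most \<open>n + 1\<close> values, so every
  function of it is bounded.\<close>

lemma integrable_depth [simp]: "integrable M (\<lambda>\<omega>. g (depth n \<omega>) :: real)"
proof (rule integrable_const_bound[where B = "\<Sum>k\<le>n. \<bar>g k\<bar>"])
  show "AE \<omega> in M. norm (g (depth n \<omega>)) \<le> (\<Sum>k\<le>n. \<bar>g k\<bar>)"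
    using depth_le[of n] by (intro AE_I2) (auto intro!: member_le_sum[of _ _ "\<lambda>k. \<bar>g k\<bar>"])
qed measurable

lemma expectation_Y_eq:
  assumes [measurable]: "f \<in> borel_measurable borel"
  shows "expectation (\<lambda>\<omega>. f (Y i \<omega>) :: real) = expectation (\<lambda>\<omega>. f (Y 0 \<omega>))"
proof -
  have "expectation (\<lambda>\<omega>. f (Y i \<omega>)) = integral\<^sup>L (distr M borel (Y i)) f" for i
    by (subst integral_distr) auto
  then show ?thesis by (metis ident)
qed

text \<open>\<open>Y 0\<close> serves as a generic copy of the attachment variable for every
  \<open>n\<close>: once independence has been used, only the law of the parent label
  matters.\<close>

definition child :: "nat \<Rightarrow> 'a \<Rightarrow> nat" where
  "child n \<omega> = nat \<lfloor>real n * Y 0 \<omega>\<rfloor>"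

lemma child_measurable [measurable]: "child n \<in> measurable M (count_space UNIV)"
  unfolding child_def[abs_def] by measurable

lemma child_less: "n > 0 \<Longrightarrow> child n \<omega> < n"
  using sarrt_parent_less[of "\<lambda>_. Y 0 \<omega>" n] range by (simp add: child_def sarrt_parent_def)

text \<open>For \<open>k < n\<close> the depth of \<open>k\<close> is a function of the block of
  variables with index below \<open>n\<close>, which is independent of \<open>Y n\<close>.\<close>

lemma indep_depth:
  assumes "k < n" and [measurable]: "f \<in> borel_measurable borel"
    and int: "integrable M (\<lambda>\<omega>. f (Y n \<omega>))"
  shows "expectation (\<lambda>\<omega>. f (Y n \<omega>) * g (depth k \<omega>) :: real) =
    expectation (\<lambda>\<omega>. f (Y n \<omega>)) * expectation (\<lambda>\<omega>. g (depth k \<omega>))"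
proof -
  let ?A = "{..<n}"
  have "indep_var (PiM {n} (\<lambda>_. borel)) (\<lambda>\<omega>. restrict (\<lambda>i. Y i \<omega>) {n})
      (PiM ?A (\<lambda>_. borel)) (\<lambda>\<omega>. restrict (\<lambda>i. Y i \<omega>) ?A)"
    by (rule indep_var_restrict[OF indep]) auto
  moreover have "(\<lambda>x. f (x n)) \<in> borel_measurable (PiM {n} (\<lambda>_. borel :: real measure))"
    by measurable
  moreover have "(\<lambda>x. g (sarrt_depth x k)) \<in> borel_measurable (PiM ?A (\<lambda>_. borel :: real measure))"
  proof -
    have "(\<lambda>x. x i) \<in> borel_measurable (PiM ?A (\<lambda>_. borel :: real measure))" for i
    proof (cases "i < n")
      \<comment> \<open>Members of the product space are \<open>undefined\<close> outside
        \<open>{..<n}\<close>, so these coordinates are constant.\<close>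
      case False
      then have "(\<lambda>x. x i) \<in> borel_measurable (PiM ?A (\<lambda>_. borel :: real measure)) \<longleftrightarrow>
          (\<lambda>x. undefined :: real) \<in> borel_measurable (PiM ?A (\<lambda>_. borel :: real measure))"
        by (intro measurable_cong) (auto simp: space_PiM PiE_def extensional_def)
      then show ?thesis by simp
    qed measurable
    then have [measurable]: "(\<lambda>x. sarrt_depth (\<lambda>i. x i) k) \<in> measurable (PiM ?A (\<lambda>_. borel :: real measure)) (count_space UNIV)"
      by (rule sarrt_depth_measurable)
    show ?thesis by measurable
  qed
  ultimately have "indep_var borel ((\<lambda>x. f (x n)) \<circ> (\<lambda>\<omega>. restrict (\<lambda>i. Y i \<omega>) {n}))
     borel ((\<lambda>x. g (sarrt_depth x k)) \<circ> (\<lambda>\<omega>. restrict (\<lambda>i. Y i \<omega>) ?A))"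
    by (rule indep_var_compose)
  moreover have "sarrt_depth (restrict (\<lambda>i. Y i \<omega>) ?A) k = depth k \<omega>" for \<omega>
    unfolding depth_def using assms(1) range by (intro sarrt_depth_cong[symmetric]) auto
  ultimately have "indep_var borel (\<lambda>\<omega>. f (Y n \<omega>)) borel (\<lambda>\<omega>. g (depth k \<omega>))"
    by (simp add: comp_def)
  then show ?thesis using int by (intro indep_var_lebesgue_integral) auto
qed

text \<open>The parent of \<open>n\<close> is a function of \<open>Y n\<close>, and all depths below \<open>n\<close> are functions of the
  other variables, so conditioning on \<open>Y n\<close> turns the depth into a Markov recursion.\<close>

lemma expectation_depth_rec:
  fixes g :: "nat \<Rightarrow> real"
  assumes "n > 0"
  shows "expectation (\<lambda>\<omega>. g (depth n \<omega>)) =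
    expectation (\<lambda>\<omega>. expectation (\<lambda>\<omega>'. g (Suc (depth (child n \<omega>) \<omega>'))))"
proof -
  let ?I = "\<lambda>k x. indicator {x. nat \<lfloor>real n * x\<rfloor> = k} x :: real"
  have [measurable]: "?I k \<in> borel_measurable borel" for k
    by measurable
  have int: "integrable M (\<lambda>\<omega>. ?I k (Y i \<omega>))" for k i
    by (rule integrable_const_bound[where B = 1]) auto
  have less: "nat \<lfloor>real n * Y i \<omega>\<rfloor> < n" for i \<omega>
    using sarrt_parent_less[of "\<lambda>_. Y i \<omega>" n] range assms by (simp add: sarrt_parent_def)
  have select: "(\<Sum>k<n. ?I k (Y i \<omega>) * h k) = h (nat \<lfloor>real n * Y i \<omega>\<rfloor>)" for h :: "nat \<Rightarrow> real" and i \<omega>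
  proof -
    have "(\<Sum>k<n. ?I k (Y i \<omega>) * h k) = (\<Sum>k<n. if k = nat \<lfloor>real n * Y i \<omega>\<rfloor> then h k else 0)"
      by (intro sum.cong) (auto simp: indicator_def)
    then show ?thesis using less by simp
  qed
  \<comment> \<open>Splitting by the label of the parent writes the depth as a finite sum of
    products of a function of \<open>Y n\<close> and a function of a depth below
    \<open>n\<close>.\<close>
  have "g (depth n \<omega>) = (\<Sum>k<n. ?I k (Y n \<omega>) * g (Suc (depth k \<omega>)))" for \<omega>
  proof -
    have "depth n \<omega> = Suc (depth (nat \<lfloor>real n * Y n \<omega>\<rfloor>) \<omega>)"
      unfolding depth_def using assms range by (subst sarrt_depth_rec) (auto simp: sarrt_parent_def)
    then show ?thesis by (simp only: select)
  qed
  then have "expectation (\<lambda>\<omega>. g (depth n \<omega>)) =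
      expectation (\<lambda>\<omega>. \<Sum>k<n. ?I k (Y n \<omega>) * g (Suc (depth k \<omega>)))"
    by simp
  also have "\<dots> = (\<Sum>k<n. expectation (\<lambda>\<omega>. ?I k (Y n \<omega>) * g (Suc (depth k \<omega>))))"
  proof (rule Bochner_Integration.integral_sum)
    fix k
    have "integrable M (\<lambda>\<omega>. \<bar>g (Suc (depth k \<omega>))\<bar>)"
      by (rule integrable_depth[of "\<lambda>d. \<bar>g (Suc d)\<bar>"])
    then show "integrable M (\<lambda>\<omega>. ?I k (Y n \<omega>) * g (Suc (depth k \<omega>)))"
      by (rule Bochner_Integration.integrable_bound) (auto simp: indicator_def)
  qed
  also have "\<dots> = (\<Sum>k<n. expectation (\<lambda>\<omega>. ?I k (Y n \<omega>)) * expectation (\<lambda>\<omega>. g (Suc (depth k \<omega>))))"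
    using int by (intro sum.cong refl indep_depth[of _ n _ "\<lambda>d. g (Suc d)"]) auto
  \<comment> \<open>After factorization only the law of \<open>Y n\<close> enters, so
    \<open>Y 0\<close> may replace it and the sum folds back into \<open>child n\<close>.\<close>
  also have "\<dots> = (\<Sum>k<n. expectation (\<lambda>\<omega>. ?I k (Y 0 \<omega>)) * expectation (\<lambda>\<omega>. g (Suc (depth k \<omega>))))"
    by (subst expectation_Y_eq) auto
  also have "\<dots> = expectation (\<lambda>\<omega>. \<Sum>k<n. ?I k (Y 0 \<omega>) * expectation (\<lambda>\<omega>'. g (Suc (depth k \<omega>'))))"
    using int by (subst Bochner_Integration.integral_sum) auto
  also have "\<dots> = expectation (\<lambda>\<omega>. expectation (\<lambda>\<omega>'. g (Suc (depth (child n \<omega>) \<omega>'))))"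
    by (simp only: select child_def)
  finally show ?thesis .
qed

section \<open>Tail probabilities of the depth\<close>

definition tail :: "nat \<Rightarrow> nat \<Rightarrow> real" where
  "tail m n = prob {\<omega>\<in>space M. m < depth n \<omega>}"

lemma tail_eq_expectation: "tail m n = expectation (\<lambda>\<omega>. of_bool (m < depth n \<omega>))"
proof -
  have "tail m n = expectation (indicator {\<omega>\<in>space M. m < depth n \<omega>})"
    by (simp add: tail_def)
  also have "\<dots> = expectation (\<lambda>\<omega>. of_bool (m < depth n \<omega>))"
    by (intro Bochner_Integration.integral_cong) (auto simp: indicator_def)
  finally show ?thesis .
qed

lemma tail_nonneg: "0 \<le> tail m n" and tail_le_1: "tail m n \<le> 1"
  by (simp_all add: tail_def)

lemma tail_0: "tail m 0 = 0"
  by (simp add: tail_def)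

lemma tail_Suc: "n > 0 \<Longrightarrow> tail (Suc m) n = expectation (\<lambda>\<omega>. tail m (child n \<omega>))"
  using expectation_depth_rec[of n "\<lambda>d. of_bool (Suc m < d)"] by (simp add: tail_eq_expectation)

lemma integrable_tail: "integrable M (\<lambda>\<omega>. tail m (child n \<omega>))"
  by (rule integrable_const_bound[where B = 1]) (auto simp: tail_nonneg tail_le_1)

lemma integrable_powr: "s > 0 \<Longrightarrow> integrable M (\<lambda>\<omega>. Y 0 \<omega> powr s)"
  using Y_nonneg Y_less_1
  by (intro integrable_const_bound[where B = 1]) (auto intro!: AE_I2 powr_le1 simp: less_imp_le)

lemma child_le: "real (child n \<omega>) \<le> real n * Y 0 \<omega>"
  using Y_nonneg[of 0 \<omega>] by (simp add: child_def)

text \<open>A Chernoff bound carried through the recursion: rounding down keeps the child label at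
  most \<open>n * Y 0\<close>, so each generation contributes one factor
  \<open>E (Y powr s)\<close>. The start uses \<open>1 <= n powr s\<close> for
  \<open>n >= 1\<close>.\<close>

lemma tail_le_powr:
  assumes "s > 0"
  shows "tail m n \<le> real n powr s * expectation (\<lambda>\<omega>. Y 0 \<omega> powr s) ^ m"
proof (induction m arbitrary: n)
  case 0
  show ?case
  proof (cases "n = 0")
    case False
    then have "1 \<le> real n powr s" using assms by (intro ge_one_powr_ge_zero) auto
    then show ?thesis using tail_le_1[of 0 n] by simp
  qed (simp add: tail_0)
next
  case (Suc m)
  let ?\<phi> = "expectation (\<lambda>\<omega>. Y 0 \<omega> powr s)"
  show ?case
  proof (cases "n = 0")
    case False
    have \<phi>: "0 \<le> ?\<phi>" by (intro Bochner_Integration.integral_nonneg) simp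
    have "tail (Suc m) n = expectation (\<lambda>\<omega>. tail m (child n \<omega>))"
      using False by (simp add: tail_Suc)
    also have "\<dots> \<le> expectation (\<lambda>\<omega>. (real n powr s * ?\<phi> ^ m) * Y 0 \<omega> powr s)"
    proof (intro integral_mono integrable_tail integrable_mult_right integrable_powr assms)
      fix \<omega>
      have "tail m (child n \<omega>) \<le> real (child n \<omega>) powr s * ?\<phi> ^ m" by (rule Suc)
      also have "\<dots> \<le> (real n * Y 0 \<omega>) powr s * ?\<phi> ^ m"
        using assms \<phi> by (intro mult_right_mono powr_mono2 child_le) auto
      finally show "tail m (child n \<omega>) \<le> (real n powr s * ?\<phi> ^ m) * Y 0 \<omega> powr s"
        using Y_nonneg[of 0 \<omega>] by (simp add: powr_mult mult_ac)
    qed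
    also have "\<dots> = real n powr s * ?\<phi> ^ Suc m"
      by simp
    finally show ?thesis .
  qed (simp add: tail_0)
qed

end

section \<open>Convergence in mean\<close>

lemma sum_power_atLeastLessThan_le:
  fixes q :: real
  assumes "0 \<le> q" "q < 1"
  shows "(\<Sum>m\<in>{k..<n}. q ^ m) \<le> q ^ k / (1 - q)"
proof (cases "k \<le> n")
  case True
  then have "(1 - q) * (\<Sum>m\<in>{k..<n}. q ^ m) = q ^ k - q ^ n"
  proof (induction n rule: dec_induct)
    case (step n)
    have "(1 - q) * (\<Sum>m\<in>{k..<Suc n}. q ^ m) = (1 - q) * (\<Sum>m\<in>{k..<n}. q ^ m) + (1 - q) * q ^ n"
      using step.hyps by (simp add: distrib_left)
    then show ?case using step.IH by (simp add: algebra_simps)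
  qed simp
  also have "\<dots> \<le> q ^ k" using assms by simp
  finally show ?thesis using assms by (simp add: field_simps)
qed (use assms in simp)

context sarrt
begin

text \<open>With \<open>q = E (Y powr s)\<close>, the condition on \<open>b\<close> makes
  \<open>n powr s * q ^ k\<close> at most \<open>1\<close> when \<open>k\<close> is
  \<open>b * ln n\<close> rounded up; beyond \<open>k\<close> the tail bound decays geometrically.
  The estimate is therefore uniform in \<open>n\<close>, and the summand \<open>1\<close> pays for
  the rounding.\<close>

lemma expectation_depth_excess_le:
  assumes s: "s > 0" and b: "b \<ge> 0" "s \<le> b * (1 - expectation (\<lambda>\<omega>. Y 0 \<omega> powr s))" and n: "n > 0"
  shows "expectation (\<lambda>\<omega>. max 0 (real (depth n \<omega>) - b * ln (real n)))
    \<le> 1 + 1 / (1 - expectation (\<lambda>\<omega>. Y 0 \<omega> powr s))"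
proof -
  define q where "q = expectation (\<lambda>\<omega>. Y 0 \<omega> powr s)"
  have q0: "0 \<le> q" unfolding q_def by (intro Bochner_Integration.integral_nonneg) simp
  have "0 < b * (1 - q)" using s b(2) by (simp add: q_def)
  then have q1: "q < 1" using b(1) by (simp add: zero_less_mult_iff)
  define k where "k = nat \<lceil>b * ln (real n)\<rceil>"
  have ln_n: "0 \<le> ln (real n)" using n by simp
  have k: "b * ln (real n) \<le> real k" "real k \<le> b * ln (real n) + 1"
    using b(1) ln_n unfolding k_def by (simp_all add: real_nat_ceiling_ge)
  \<comment> \<open>The depth is written as a sum of indicators over levels; levels up to
    \<open>n\<close> suffice because the depth is at most \<open>n\<close>.\<close>
  have "max 0 (real (depth n \<omega>) - b * ln (real n))
      \<le> 1 + (\<Sum>m\<in>{k..<n}. of_bool (m < depth n \<omega>))" for \<omega>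
  proof -
    have "(\<Sum>m\<in>{k..<n}. of_bool (m < depth n \<omega>) :: real) = real (card ({k..<n} \<inter> {m. m < depth n \<omega>}))"
      by (subst sum_of_bool_eq) auto
    also have "{k..<n} \<inter> {m. m < depth n \<omega>} = {k..<depth n \<omega>}"
      using depth_le[of n \<omega>] by auto
    finally show ?thesis using k(2) by (cases "k \<le> depth n \<omega>") (auto simp: of_nat_diff)
  qed
  then have "expectation (\<lambda>\<omega>. max 0 (real (depth n \<omega>) - b * ln (real n)))
      \<le> expectation (\<lambda>\<omega>. 1 + (\<Sum>m\<in>{k..<n}. of_bool (m < depth n \<omega>)))"
    by (intro integral_mono integrable_depth[of "\<lambda>d. max 0 (real d - b * ln (real n))"]
        integrable_depth[of "\<lambda>d. 1 + (\<Sum>m\<in>{k..<n}. of_bool (m < d))"])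
  also have "\<dots> = 1 + (\<Sum>m\<in>{k..<n}. tail m n)"
    using integrable_depth[of "\<lambda>d. of_bool (_ < d)"]
    by (simp add: tail_eq_expectation prob_space del: sum_of_bool_eq)
  also have "\<dots> \<le> 1 + (\<Sum>m\<in>{k..<n}. real n powr s * q ^ m)"
    using tail_le_powr[OF s] unfolding q_def by (intro add_left_mono sum_mono)
  also have "\<dots> = 1 + real n powr s * (\<Sum>m\<in>{k..<n}. q ^ m)"
    by (simp add: sum_distrib_left)
  also have "\<dots> \<le> 1 + real n powr s * (q ^ k / (1 - q))"
    using q0 q1 by (intro add_left_mono mult_left_mono sum_power_atLeastLessThan_le) auto
  also have "\<dots> \<le> 1 + 1 / (1 - q)"
  proof -
    \<comment> \<open>The inequality \<open>1 + u <= exp u\<close> turns the condition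
      \<open>s <= b * (1 - q)\<close> into \<open>q ^ k <= n powr (- s)\<close>.\<close>
    have "q \<le> exp (- (1 - q))" using exp_ge_add_one_self[of "- (1 - q)"] by simp
    then have "q ^ k \<le> exp (- (1 - q)) ^ k" using q0 by (intro power_mono)
    also have "\<dots> = exp (- ((1 - q) * real k))"
      by (simp add: exp_of_nat_mult[symmetric] mult.commute algebra_simps)
    also have "\<dots> \<le> exp (- (s * ln (real n)))"
    proof -
      have "s * ln (real n) \<le> (b * (1 - q)) * ln (real n)"
        using b(2) ln_n unfolding q_def by (intro mult_right_mono)
      also have "\<dots> = (1 - q) * (b * ln (real n))" by simp
      also have "\<dots> \<le> (1 - q) * real k" using k(1) q1 by (intro mult_left_mono) auto
      finally show ?thesis by simp
    qed
    finally have "real n powr s * q ^ k \<le> real n powr s * exp (- (s * ln (real n)))"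
      by (intro mult_left_mono) auto
    also have "\<dots> = 1" using n by (simp add: powr_def exp_minus)
    finally show ?thesis using q1 by (simp add: divide_right_mono)
  qed
  finally show ?thesis by (simp add: q_def)
qed

text \<open>Fatou's lemma for \<open>(1 - Y powr s) / s\<close> along \<open>s = 1 / (k + 1)\<close>; this covers \<open>Y = 0\<close>,
  where the quotient tends to infinity.\<close>

lemma exists_powr_exponent:
  assumes c: "ennreal c < neg_log_mean M (Y 0)" "c \<ge> 0"
  shows "\<exists>s>0. c * s \<le> 1 - expectation (\<lambda>\<omega>. Y 0 \<omega> powr s)"
proof -
  define f where "f = (\<lambda>(k::nat) y. real (Suc k) * (1 - y powr (1 / real (Suc k))))"
  have f_nonneg: "0 \<le> f k (Y 0 \<omega>)" for k \<omega>
    unfolding f_def using Y_nonneg[of 0 \<omega>] Y_less_1[of 0 \<omega>]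
    by (intro mult_nonneg_nonneg) (auto intro!: powr_le1)
  have lim: "(\<lambda>k. ennreal (f k (Y 0 \<omega>))) \<longlonglongrightarrow> neg_log (Y 0 \<omega>)" for \<omega>
  proof (cases "Y 0 \<omega> = 0")
    case True
    have "filterlim (\<lambda>k. real (Suc k)) at_top sequentially" by real_asymp
    then show ?thesis using True
      by (simp add: f_def neg_log_def tendsto_ennreal_iff ennreal_tendsto_top_eq_at_top del: of_nat_Suc)
  next
    case False
    then have "Y 0 \<omega> > 0" using Y_nonneg[of 0 \<omega>] by simp
    then have "(\<lambda>k. f k (Y 0 \<omega>)) \<longlonglongrightarrow> - ln (Y 0 \<omega>)"
      unfolding f_def by real_asymp
    then show ?thesis using False by (simp add: neg_log_def tendsto_ennrealI)
  qed
  have [measurable]: "(\<lambda>\<omega>. ennreal (f k (Y 0 \<omega>))) \<in> borel_measurable M" for k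
    unfolding f_def by measurable
  have "neg_log_mean M (Y 0) = (\<integral>\<^sup>+ \<omega>. liminf (\<lambda>k. ennreal (f k (Y 0 \<omega>))) \<partial>M)"
    unfolding neg_log_mean_def by (intro nn_integral_cong) (simp add: lim_imp_Liminf[OF _ lim])
  also have "\<dots> \<le> liminf (\<lambda>k. \<integral>\<^sup>+ \<omega>. ennreal (f k (Y 0 \<omega>)) \<partial>M)"
    by (rule nn_integral_liminf) measurable
  finally have "ennreal c < liminf (\<lambda>k. \<integral>\<^sup>+ \<omega>. ennreal (f k (Y 0 \<omega>)) \<partial>M)"
    using c by simp
  then have "\<forall>\<^sub>F k in sequentially. ennreal c < (\<integral>\<^sup>+ \<omega>. ennreal (f k (Y 0 \<omega>)) \<partial>M)"
    by (rule less_LiminfD)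
  then obtain k where k: "ennreal c < (\<integral>\<^sup>+ \<omega>. ennreal (f k (Y 0 \<omega>)) \<partial>M)"
    by (auto simp: eventually_sequentially)
  define s where "s = 1 / real (Suc k)"
  have s: "s > 0" by (simp add: s_def)
  have "(\<integral>\<^sup>+ \<omega>. ennreal (f k (Y 0 \<omega>)) \<partial>M) = ennreal (expectation (\<lambda>\<omega>. f k (Y 0 \<omega>)))"
    using f_nonneg integrable_powr[OF s] unfolding f_def s_def
    by (intro nn_integral_eq_integral) auto
  also have "expectation (\<lambda>\<omega>. f k (Y 0 \<omega>)) = (1 - expectation (\<lambda>\<omega>. Y 0 \<omega> powr s)) / s"
    using integrable_powr[OF s] unfolding f_def s_def by (simp add: prob_space)
  finally have "c < (1 - expectation (\<lambda>\<omega>. Y 0 \<omega> powr s)) / s"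
    using k c(2) by (simp add: ennreal_less_iff)
  then show ?thesis using s by (intro exI[of _ s]) (simp add: field_simps)
qed

text \<open>For the child label \<open>c\<close>, \<open>n * Y 0 < c + 1 = c * (1 + 1 / c)\<close>,
  and \<open>ln (1 + 1 / c) <= 1 / c <= 1 / K\<close>. This is the cost of one rounding.\<close>

lemma ln_child_ge:
  assumes "K > 0" "K \<le> child n \<omega>"
  shows "ln (real n) + ln (Y 0 \<omega>) \<le> ln (real (child n \<omega>)) + 1 / real K"
proof -
  let ?c = "real (child n \<omega>)"
  have c: "?c > 0" using assms by simp
  with child_le[of n \<omega>] have "real n * Y 0 \<omega> > 0" by linarith
  then have n: "n > 0" "Y 0 \<omega> > 0"
    using Y_nonneg[of 0 \<omega>] by (auto simp: zero_less_mult_iff)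
  have "real n * Y 0 \<omega> < ?c + 1"
    unfolding child_def using Y_nonneg[of 0 \<omega>] by linarith
  also have "?c + 1 = ?c * (1 + 1 / ?c)" using c by (simp add: distrib_left)
  finally have "real n * Y 0 \<omega> \<le> ?c * (1 + 1 / ?c)" by simp
  then have "ln (real n * Y 0 \<omega>) \<le> ln (?c * (1 + 1 / ?c))"
    using n c by (subst ln_le_cancel_iff) (auto intro!: mult_pos_pos add_pos_pos)
  also have "\<dots> = ln ?c + ln (1 + 1 / ?c)"
    using c add_pos_pos[of 1 "1 / ?c"] by (subst ln_mult_pos) auto
  also have "ln (1 + 1 / ?c) \<le> 1 / ?c" using c by (intro ln_add_one_self_le_self) auto
  also have "1 / ?c \<le> 1 / real K" using assms by (intro divide_left_mono) auto
  finally show ?thesis using n by (simp add: ln_mult)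
qed

text \<open>The complementary case: since \<open>K\<close> is an integer, a rounded value below
  \<open>K\<close> comes from an unrounded value below \<open>K\<close>.\<close>

lemma ln_child_less:
  assumes "child n \<omega> < K" "n > 0" "Y 0 \<omega> > 0"
  shows "ln (real n) + ln (Y 0 \<omega>) < ln (real K)"
proof -
  have "real n * Y 0 \<omega> < real K" using assms(1) unfolding child_def by linarith
  then have "ln (real n * Y 0 \<omega>) < ln (real K)" using assms by (subst ln_less_cancel_iff) auto
  then show ?thesis using assms by (simp add: ln_mult)
qed

end

section \<open>Finite mean: lower bound for the expected depth\<close>

locale sarrt_finite_mean = sarrt +
  assumes finite_mean: "neg_log_mean M (Y 0) < \<infinity>"
begin

text \<open>A real-valued version of the extended mean. The two agree because a finite mean forces
  \<open>Y 0 > 0\<close> almost surely, so the value of \<open>ln 0\<close> enters only on a null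
  set.\<close>

definition mean :: real where
  "mean = expectation (\<lambda>\<omega>. - ln (Y 0 \<omega>))"

lemma AE_Y_pos: "AE \<omega> in M. Y 0 \<omega> > 0"
proof -
  have "AE \<omega> in M. neg_log (Y 0 \<omega>) \<noteq> \<infinity>"
    using finite_mean unfolding neg_log_mean_def neg_log_def by (intro nn_integral_PInf_AE) auto
  then show ?thesis
    by eventually_elim (use Y_nonneg[of 0] in \<open>auto simp: neg_log_def less_le split: if_splits\<close>)
qed

lemma ln_Y_nonpos: "ln (Y i \<omega>) \<le> 0"
  using range[of i \<omega>] by (cases "Y i \<omega> = 0") auto

lemma nn_integral_neg_ln: "(\<integral>\<^sup>+ \<omega>. ennreal (- ln (Y 0 \<omega>)) \<partial>M) = neg_log_mean M (Y 0)"
  unfolding neg_log_mean_def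
  using AE_Y_pos by (intro nn_integral_cong_AE) (auto simp: neg_log_def elim!: eventually_mono)

lemma integrable_ln: "integrable M (\<lambda>\<omega>. ln (Y 0 \<omega>))"
proof -
  have "integrable M (\<lambda>\<omega>. - ln (Y 0 \<omega>))"
    using nn_integral_neg_ln finite_mean ln_Y_nonpos by (intro integrableI_nonneg) auto
  then show ?thesis by simp
qed

lemma mean_eq: "mean = enn2real (neg_log_mean M (Y 0))"
  unfolding mean_def nn_integral_neg_ln[symmetric] using ln_Y_nonpos
  by (intro integral_eq_nn_integral) auto

lemma neg_log_mean_eq: "neg_log_mean M (Y 0) = ennreal mean"
  using finite_mean by (simp add: mean_eq)

text \<open>A vanishing mean would force \<open>Y 0 = 1\<close> almost surely, against
  \<open>Y 0 < 1\<close>.\<close>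

lemma mean_pos: "mean > 0"
proof -
  have "mean \<noteq> 0"
  proof
    assume "mean = 0"
    then have "AE \<omega> in M. - ln (Y 0 \<omega>) = 0"
      unfolding mean_def using integrable_ln ln_Y_nonpos
      by (subst (asm) integral_nonneg_eq_0_iff_AE) auto
    with AE_Y_pos have "AE \<omega> in M. False"
      by eventually_elim (use Y_less_1[of 0] in \<open>auto simp: less_le\<close>)
    then show False by simp
  qed
  moreover have "mean \<ge> 0" by (simp add: mean_eq)
  ultimately show ?thesis by simp
qed

text \<open>The left side is a subsolution of the recursion: one generation lowers the logarithm on
  average by at most \<open>mean + 1 / K\<close>, and after division by this number the loss is
  exactly the one generation gained.\<close>

lemma expectation_depth_ge:
  assumes K: "K > 0"
  shows "n > 0 \<Longrightarrow> (ln (real n) - ln (real K)) / (mean + 1 / real K) \<le> expectation (\<lambda>\<omega>. real (depth n \<omega>))"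
proof (induction n rule: less_induct)
  case (less n)
  let ?h = "\<lambda>n. expectation (\<lambda>\<omega>. real (depth n \<omega>))"
  define a where "a = 1 / (mean + 1 / real K)"
  have a: "a > 0" "a * (mean + 1 / real K) = 1"
    using mean_pos K unfolding a_def by (auto intro!: divide_pos_pos add_pos_pos simp: add_pos_pos less_imp_neq[symmetric])
  have h_nonneg: "0 \<le> ?h k" for k by (intro Bochner_Integration.integral_nonneg) simp
  have "AE \<omega> in M. a * (ln (real n) + ln (Y 0 \<omega>) - 1 / real K - ln (real K)) \<le> ?h (child n \<omega>)"
    using AE_Y_pos
  proof eventually_elim
    case (elim \<omega>)
    show ?case
    proof (cases "K \<le> child n \<omega>")
      case True
      have "a * (ln (real n) + ln (Y 0 \<omega>) - 1 / real K - ln (real K)) \<le> a * (ln (real (child n \<omega>)) - ln (real K))"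
        using ln_child_ge[OF K True] a by (intro mult_left_mono) auto
      also have "\<dots> \<le> ?h (child n \<omega>)"
        using less.IH[OF child_less[OF less.prems]] K True by (simp add: a_def)
      finally show ?thesis .
    next
      \<comment> \<open>Once the child lies below \<open>K\<close> the claimed bound is not
        positive, so non-negativity of the expected depth suffices.\<close>
      case False
      then have "ln (real n) + ln (Y 0 \<omega>) - 1 / real K - ln (real K) \<le> 0"
        using ln_child_less[of n \<omega> K] elim less.prems
          divide_nonneg_nonneg[of 1 "real K"] by linarith
      then show ?thesis using h_nonneg[of "child n \<omega>"] a(1)
        by (meson mult_nonneg_nonpos order_less_imp_le order_trans)
    qed
  qed
  moreover have "integrable M (\<lambda>\<omega>. ?h (child n \<omega>))"
  proof (rule integrable_const_bound[where B = "\<Sum>k<n. ?h k"])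
    show "AE \<omega> in M. norm (?h (child n \<omega>)) \<le> (\<Sum>k<n. ?h k)"
      using child_less[OF less.prems] h_nonneg
      by (intro AE_I2) (auto intro!: member_le_sum[of _ _ ?h])
  qed measurable
  ultimately have "expectation (\<lambda>\<omega>. a * (ln (real n) + ln (Y 0 \<omega>) - 1 / real K - ln (real K)))
      \<le> expectation (\<lambda>\<omega>. ?h (child n \<omega>))"
    using integrable_ln by (intro integral_mono_AE) auto
  moreover have "expectation (\<lambda>\<omega>. a * (ln (real n) + ln (Y 0 \<omega>) - 1 / real K - ln (real K)))
      = a * (ln (real n) - ln (real K)) - a * (mean + 1 / real K)"
    using integrable_ln by (simp add: mean_def prob_space algebra_simps)
  moreover have "?h n = 1 + expectation (\<lambda>\<omega>. ?h (child n \<omega>))"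
  proof -
    have "integrable M (\<lambda>\<omega>. real (depth k \<omega>))" for k by (rule integrable_depth)
    then show ?thesis
      using expectation_depth_rec[OF less.prems, of real] \<open>integrable M (\<lambda>\<omega>. ?h (child n \<omega>))\<close>
      by (simp add: prob_space)
  qed
  ultimately show ?case using a(2) by (simp add: a_def)
qed

end

section \<open>Convergence in probability and of expectations\<close>

context sarrt
begin

text \<open>Convergence in mean from one-sided bounds: \<open>\<bar>u\<bar> = 2 max 0 u - u\<close>, so it suffices
  to bound the positive part from above and the mean from below.\<close>

lemma depth_L1_convergence:
  assumes a: "a \<ge> 0"
    and upper: "\<And>b. b > a \<Longrightarrow> \<exists>s>0. s \<le> b * (1 - expectation (\<lambda>\<omega>. Y 0 \<omega> powr s))"
    and lower: "\<And>c. c < a \<Longrightarrow> \<forall>\<^sub>F n in sequentially. c * ln (real n) \<le> expectation (\<lambda>\<omega>. real (depth n \<omega>))"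
  shows "(\<lambda>n. expectation (\<lambda>\<omega>. \<bar>real (depth n \<omega>) / ln (real n) - a\<bar>)) \<longlonglongrightarrow> 0"
proof (rule tendstoI)
  fix e :: real assume "e > 0"
  \<comment> \<open>The final bound is \<open>2 * C + 3 * \<delta> * ln n\<close>; for large
    \<open>n\<close> the constant is below \<open>\<delta> * ln n\<close>, which gives
    \<open>4 * \<delta> = e\<close> in total.\<close>
  define \<delta> where "\<delta> = e / 4"
  have \<delta>: "\<delta> > 0" using \<open>e > 0\<close> by (simp add: \<delta>_def)
  obtain s where s: "s > 0" "s \<le> (a + \<delta>) * (1 - expectation (\<lambda>\<omega>. Y 0 \<omega> powr s))"
    using upper[of "a + \<delta>"] \<delta> by auto
  define C where "C = 1 + 1 / (1 - expectation (\<lambda>\<omega>. Y 0 \<omega> powr s))"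
  have "\<forall>\<^sub>F n in sequentially. 2 * C < \<delta> * ln (real n)"
    using \<delta> by real_asymp
  moreover have "\<forall>\<^sub>F n in sequentially. (a - \<delta>) * ln (real n) \<le> expectation (\<lambda>\<omega>. real (depth n \<omega>))"
    using \<delta> by (intro lower) auto
  ultimately show "\<forall>\<^sub>F n in sequentially.
      dist (expectation (\<lambda>\<omega>. \<bar>real (depth n \<omega>) / ln (real n) - a\<bar>)) 0 < e"
    using eventually_gt_at_top[of 1]
  proof eventually_elim
    case (elim n)
    have ln_n: "ln (real n) > 0" using elim by simp
    \<comment> \<open>Moving the truncation level from \<open>a\<close> to
      \<open>a + \<delta>\<close> costs \<open>\<delta> * ln n\<close>, doubled by the factor in
      front of the positive part.\<close>
    have "\<bar>real (depth n \<omega>) / ln (real n) - a\<bar> * ln (real n)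
        \<le> 2 * max 0 (real (depth n \<omega>) - (a + \<delta>) * ln (real n)) + (a + 2 * \<delta>) * ln (real n) - real (depth n \<omega>)" for \<omega>
    proof -
      have "\<bar>real (depth n \<omega>) / ln (real n) - a\<bar> * ln (real n) = \<bar>real (depth n \<omega>) - a * ln (real n)\<bar>"
        using ln_n abs_mult[of "real (depth n \<omega>) / ln (real n) - a" "ln (real n)"]
        by (simp add: left_diff_distrib)
      moreover have "\<delta> * ln (real n) > 0" using \<delta> ln_n by simp
      ultimately show ?thesis by (auto simp: max_def abs_if algebra_simps)
    qed
    then have "expectation (\<lambda>\<omega>. \<bar>real (depth n \<omega>) / ln (real n) - a\<bar> * ln (real n))
        \<le> expectation (\<lambda>\<omega>. 2 * max 0 (real (depth n \<omega>) - (a + \<delta>) * ln (real n)) + (a + 2 * \<delta>) * ln (real n) - real (depth n \<omega>))"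
      by (intro integral_mono integrable_depth[of "\<lambda>d. \<bar>real d / ln (real n) - a\<bar> * ln (real n)"]
        integrable_depth[of "\<lambda>d. 2 * max 0 (real d - (a + \<delta>) * ln (real n)) + (a + 2 * \<delta>) * ln (real n) - real d"])
    also have "\<dots> = 2 * expectation (\<lambda>\<omega>. max 0 (real (depth n \<omega>) - (a + \<delta>) * ln (real n)))
        + (a + 2 * \<delta>) * ln (real n) - expectation (\<lambda>\<omega>. real (depth n \<omega>))"
      using integrable_depth[of "\<lambda>d. max 0 (real d - (a + \<delta>) * ln (real n))" n] integrable_depth[of real n]
      by (simp add: prob_space)
    also have "\<dots> \<le> 2 * C + (a + 2 * \<delta>) * ln (real n) - (a - \<delta>) * ln (real n)"
      using expectation_depth_excess_le[OF s(1) _ s(2), of n] elim a \<delta> by (simp add: C_def)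
    also have "\<dots> < 4 * \<delta> * ln (real n)" using elim by (simp add: algebra_simps)
    finally have "expectation (\<lambda>\<omega>. \<bar>real (depth n \<omega>) / ln (real n) - a\<bar>) < e"
      using ln_n by (simp add: \<delta>_def)
    then show ?case by (simp add: Bochner_Integration.integral_nonneg)
  qed
qed

lemma depth_tendsto_in_prob:
  assumes "(\<lambda>n. expectation (\<lambda>\<omega>. \<bar>real (depth n \<omega>) / ln (real n) - a\<bar>)) \<longlonglongrightarrow> 0"
  shows "tendsto_in_prob M (\<lambda>n \<omega>. real (depth n \<omega>) / ln (real n)) a"
  unfolding tendsto_in_prob_def
proof (intro allI impI)
  fix e :: real assume e: "e > 0"
  show "(\<lambda>n. measure M {\<omega> \<in> space M. e < \<bar>real (depth n \<omega>) / ln (real n) - a\<bar>}) \<longlonglongrightarrow> 0"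
  proof (rule tendsto_sandwich[OF _ _ tendsto_const])
    show "(\<lambda>n. expectation (\<lambda>\<omega>. \<bar>real (depth n \<omega>) / ln (real n) - a\<bar>) / e) \<longlonglongrightarrow> 0"
      using tendsto_divide[OF assms tendsto_const[of e]] e by simp
    have "measure M {\<omega> \<in> space M. e < \<bar>real (depth n \<omega>) / ln (real n) - a\<bar>}
      \<le> expectation (\<lambda>\<omega>. \<bar>real (depth n \<omega>) / ln (real n) - a\<bar>) / e" for n
    proof -
      have "measure M {\<omega> \<in> space M. e < \<bar>real (depth n \<omega>) / ln (real n) - a\<bar>}
          \<le> measure M {\<omega> \<in> space M. e \<le> \<bar>real (depth n \<omega>) / ln (real n) - a\<bar>}"
        by (intro finite_measure_mono) auto
      also have "\<dots> \<le> expectation (\<lambda>\<omega>. \<bar>real (depth n \<omega>) / ln (real n) - a\<bar>) / e"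
        using e integrable_depth[of "\<lambda>d. \<bar>real d / ln (real n) - a\<bar>"]
        by (intro integral_Markov_inequality_measure[where A = "{}"]) auto
      finally show ?thesis .
    qed
    then show "\<forall>\<^sub>F n in sequentially. measure M {\<omega> \<in> space M. e < \<bar>real (depth n \<omega>) / ln (real n) - a\<bar>}
      \<le> expectation (\<lambda>\<omega>. \<bar>real (depth n \<omega>) / ln (real n) - a\<bar>) / e" by simp
  qed simp
qed

lemma expectation_depth_tendsto:
  assumes "(\<lambda>n. expectation (\<lambda>\<omega>. \<bar>real (depth n \<omega>) / ln (real n) - a\<bar>)) \<longlonglongrightarrow> 0"
  shows "(\<lambda>n. expectation (\<lambda>\<omega>. real (depth n \<omega>)) / ln (real n)) \<longlonglongrightarrow> a"
proof -
  have "\<bar>expectation (\<lambda>\<omega>. real (depth n \<omega>)) / ln (real n) - a\<bar>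
      \<le> expectation (\<lambda>\<omega>. \<bar>real (depth n \<omega>) / ln (real n) - a\<bar>)" for n
  proof -
    have "expectation (\<lambda>\<omega>. real (depth n \<omega>)) / ln (real n) - a
        = expectation (\<lambda>\<omega>. real (depth n \<omega>) / ln (real n) - a)"
      using integrable_depth[of "\<lambda>d. real d / ln (real n)" n] by (simp add: prob_space)
    then show ?thesis
      using integral_abs_bound[of M "\<lambda>\<omega>. real (depth n \<omega>) / ln (real n) - a"] by (simp only:)
  qed
  then have "(\<lambda>n. expectation (\<lambda>\<omega>. real (depth n \<omega>)) / ln (real n) - a) \<longlonglongrightarrow> 0"
    by (intro Lim_null_comparison[OF _ assms]) auto
  then show ?thesis by (simp add: LIM_zero_iff)
qed

text \<open>With infinite mean every finite \<open>1 / b\<close> lies below it, so every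
  \<open>b > 0\<close> admits an exponent \<open>s\<close>. The lower bound is trivial because the
  depth is non-negative.\<close>

lemma depth_L1_convergence_infinite_mean:
  assumes "neg_log_mean M (Y 0) = \<infinity>"
  shows "(\<lambda>n. expectation (\<lambda>\<omega>. \<bar>real (depth n \<omega>) / ln (real n) - 0\<bar>)) \<longlonglongrightarrow> 0"
proof (rule depth_L1_convergence)
  fix b :: real assume "b > 0"
  obtain s where "s > 0" "1 / b * s \<le> 1 - expectation (\<lambda>\<omega>. Y 0 \<omega> powr s)"
    using exists_powr_exponent[of "1 / b"] assms \<open>b > 0\<close> by auto
  then show "\<exists>s>0. s \<le> b * (1 - expectation (\<lambda>\<omega>. Y 0 \<omega> powr s))"
    using \<open>b > 0\<close> by (intro exI[of _ s]) (simp add: field_simps)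
next
  fix c :: real assume "c < 0"
  have "c * ln (real n) \<le> expectation (\<lambda>\<omega>. real (depth n \<omega>))" if "n > 0" for n
  proof -
    have "c * ln (real n) \<le> 0" using \<open>c < 0\<close> that by (intro mult_nonpos_nonneg) auto
    also have "0 \<le> expectation (\<lambda>\<omega>. real (depth n \<omega>))"
      by (intro Bochner_Integration.integral_nonneg) simp
    finally show ?thesis .
  qed
  then show "\<forall>\<^sub>F n in sequentially. c * ln (real n) \<le> expectation (\<lambda>\<omega>. real (depth n \<omega>))"
    by (intro eventually_mono[OF eventually_gt_at_top[of 0]])
qed simp

end

context sarrt_finite_mean
begin

lemma depth_L1_convergence_finite_mean:
  "(\<lambda>n. expectation (\<lambda>\<omega>. \<bar>real (depth n \<omega>) / ln (real n) - 1 / mean\<bar>)) \<longlonglongrightarrow> 0"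
proof (rule depth_L1_convergence)
  fix b :: real assume b: "b > 1 / mean"
  then have "b > 0" using mean_pos by (meson zero_less_divide_1_iff order_less_trans)
  then have "ennreal (1 / b) < neg_log_mean M (Y 0)"
    using b mean_pos by (subst neg_log_mean_eq, subst ennreal_less_iff) (auto simp: field_simps)
  then obtain s where "s > 0" "1 / b * s \<le> 1 - expectation (\<lambda>\<omega>. Y 0 \<omega> powr s)"
    using exists_powr_exponent[of "1 / b"] \<open>b > 0\<close> by auto
  then show "\<exists>s>0. s \<le> b * (1 - expectation (\<lambda>\<omega>. Y 0 \<omega> powr s))"
    using \<open>b > 0\<close> by (intro exI[of _ s]) (simp add: field_simps)
next
  fix c :: real assume c: "c < 1 / mean"
  \<comment> \<open>A fixed large \<open>K\<close> brings the slope of the lower bound above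
    \<open>c\<close>; the term \<open>ln K\<close> is then absorbed by the surplus in slope.\<close>
  have "(\<lambda>K. 1 / (mean + 1 / real K)) \<longlonglongrightarrow> 1 / mean"
    using mean_pos by (auto intro!: tendsto_eq_intros lim_1_over_n)
  then have "\<forall>\<^sub>F K in sequentially. c < 1 / (mean + 1 / real K)"
    using c by (rule order_tendstoD)
  then have "\<forall>\<^sub>F K in sequentially. c < 1 / (mean + 1 / real K) \<and> K > 0"
    using eventually_gt_at_top[of 0] by eventually_elim simp
  then obtain K :: nat where K: "c < 1 / (mean + 1 / real K)" "K > 0"
    by (auto simp: eventually_sequentially)
  define d where "d = 1 / (mean + 1 / real K)"
  have "c < d" using K by (simp add: d_def)
  then have "\<forall>\<^sub>F n in sequentially. c * ln (real n) \<le> d * (ln (real n) - ln (real K))"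
    by real_asymp
  then show "\<forall>\<^sub>F n in sequentially. c * ln (real n) \<le> expectation (\<lambda>\<omega>. real (depth n \<omega>))"
    using eventually_gt_at_top[of 0]
  proof eventually_elim
    case (elim n)
    then show ?case using expectation_depth_ge[OF K(2), of n] by (simp add: d_def)
  qed
qed (use mean_pos in simp)

section \<open>Comparison with a random walk\<close>

text \<open>The walk uses the first \<open>m\<close> variables and not those along the path: it is
  compared with the depth in law only, not pointwise.\<close>

definition walk :: "nat \<Rightarrow> 'a \<Rightarrow> real" where
  "walk m \<omega> = (\<Sum>i<m. - ln (Y i \<omega>))"

lemma walk_measurable [measurable]: "walk m \<in> borel_measurable M"
  unfolding walk_def[abs_def] by measurable

lemma walk_nonneg: "0 \<le> walk m \<omega>"
  unfolding walk_def using ln_Y_nonpos by (intro sum_nonneg) simp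

text \<open>The probability is that of a section of a measurable set in the product space. This is
  needed to integrate it over a random shift.\<close>

lemma prob_walk_measurable [measurable]:
  assumes [measurable]: "A \<in> sets borel"
  shows "(\<lambda>x. prob {\<omega>\<in>space M. walk m \<omega> - x \<in> A}) \<in> borel_measurable borel"
proof -
  have "{\<omega>\<in>space M. walk m \<omega> - x \<in> A} = Pair x -` {p \<in> space (borel \<Otimes>\<^sub>M M). walk m (snd p) - fst p \<in> A}" for x
    by (auto simp: space_pair_measure)
  moreover have "{p \<in> space (borel \<Otimes>\<^sub>M M). walk m (snd p) - fst p \<in> A} \<in> sets (borel \<Otimes>\<^sub>M M)"
    by measurable
  ultimately show ?thesis
    unfolding measure_def by (simp only:) (intro borel_measurable_enn2real measurable_emeasure_Pair)
qed

text \<open>Conditioning on the last increment, which is independent of the earlier ones, gives a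
  convolution. Replacing \<open>Y m\<close> by \<open>Y 0\<close> brings it into the same form as
  \<open>tail_Suc\<close>.\<close>

lemma prob_walk_Suc:
  assumes A [measurable]: "A \<in> sets borel"
  shows "prob {\<omega>\<in>space M. walk (Suc m) \<omega> \<in> A} =
    expectation (\<lambda>\<omega>. prob {\<omega>'\<in>space M. walk m \<omega>' - ln (Y 0 \<omega>) \<in> A})"
proof -
  let ?step = "\<lambda>\<omega>. - ln (Y m \<omega>)"
  have ind: "indep_var borel ?step borel (walk m)"
    unfolding walk_def[abs_def]
    by (rule indep_vars_sum[where X = "\<lambda>i \<omega>. - ln (Y i \<omega>)"])
       (auto intro!: indep_vars_compose2[OF indep_vars_subset[OF indep], where Y = "\<lambda>i x. - ln x"])
  interpret W: prob_space "distr M borel (walk m)" by (rule prob_space_distr) measurable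
  interpret S: prob_space "distr M borel ?step" by (rule prob_space_distr) measurable
  have "emeasure M {\<omega>\<in>space M. walk (Suc m) \<omega> \<in> A} = emeasure (distr M borel (\<lambda>\<omega>. ?step \<omega> + walk m \<omega>)) A"
    by (subst emeasure_distr) (auto simp: walk_def intro!: arg_cong[where f = "emeasure M"])
  also have "distr M borel (\<lambda>\<omega>. ?step \<omega> + walk m \<omega>) = convolution (distr M borel ?step) (distr M borel (walk m))"
    by (rule sum_indep_random_variable[OF ind]) measurable
  also have "emeasure \<dots> A = (\<integral>\<^sup>+ x. emeasure (distr M borel (walk m)) {a. a + x \<in> A} \<partial>distr M borel ?step)"
    by (intro convolution_emeasure W.finite_measure_axioms S.finite_measure_axioms) auto
  \<comment> \<open>The shift is written as a subtraction, the form in which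
    \<open>prob_walk_measurable\<close> gives measurability in \<open>x\<close>.\<close>
  also have "\<dots> = (\<integral>\<^sup>+ x. ennreal (prob {\<omega>\<in>space M. walk m \<omega> - (- x) \<in> A}) \<partial>distr M borel ?step)"
    by (intro nn_integral_cong, subst emeasure_distr)
       (auto simp: emeasure_eq_measure intro!: arg_cong[where f = prob])
  also have "\<dots> = (\<integral>\<^sup>+ \<omega>. ennreal (prob {\<omega>'\<in>space M. walk m \<omega>' - ln (Y m \<omega>) \<in> A}) \<partial>M)"
    by (subst nn_integral_distr) auto
  also have "\<dots> = ennreal (expectation (\<lambda>\<omega>. prob {\<omega>'\<in>space M. walk m \<omega>' - ln (Y m \<omega>) \<in> A}))"
    by (intro nn_integral_eq_integral integrable_const_bound[where B = 1]) auto
  also have "\<dots> = ennreal (expectation (\<lambda>\<omega>. prob {\<omega>'\<in>space M. walk m \<omega>' - ln (Y 0 \<omega>) \<in> A}))"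
    by (subst expectation_Y_eq) auto
  finally show ?thesis
    by (simp add: emeasure_eq_measure Bochner_Integration.integral_nonneg)
qed

lemma integrable_prob_walk:
  assumes [measurable]: "A \<in> sets borel"
  shows "integrable M (\<lambda>\<omega>. prob {\<omega>'\<in>space M. walk m \<omega>' - ln (Y 0 \<omega>) \<in> A})"
  by (intro integrable_const_bound[where B = 1]) auto

text \<open>Rounding down can only speed up the descent of the logarithm, and a label that is still
  positive has logarithm at least \<open>0\<close>. A child equal to the root has zero tail.\<close>

lemma tail_le_walk:
  assumes "n > 0"
  shows "tail m n \<le> prob {\<omega>\<in>space M. walk m \<omega> \<le> ln (real n)}"
  using assms
proof (induction m arbitrary: n)
  case 0
  then show ?case using tail_le_1[of 0 n] by (simp add: walk_def prob_space)
next
  case (Suc m)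
  have "tail (Suc m) n = expectation (\<lambda>\<omega>. tail m (child n \<omega>))"
    using Suc.prems by (rule tail_Suc)
  also have "\<dots> \<le> expectation (\<lambda>\<omega>. prob {\<omega>'\<in>space M. walk m \<omega>' - ln (Y 0 \<omega>) \<in> {..ln (real n)}})"
  proof (intro integral_mono_AE integrable_tail integrable_prob_walk)
    show "AE \<omega> in M. tail m (child n \<omega>) \<le> prob {\<omega>'\<in>space M. walk m \<omega>' - ln (Y 0 \<omega>) \<in> {..ln (real n)}}"
      using AE_Y_pos
    proof eventually_elim
      case (elim \<omega>)
      show ?case
      proof (cases "child n \<omega> = 0")
        case False
        then have "ln (real (child n \<omega>)) \<le> ln (real n * Y 0 \<omega>)"
          using child_le[of n \<omega>] elim Suc.prems by (subst ln_le_cancel_iff) auto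
        then have "ln (real (child n \<omega>)) \<le> ln (real n) + ln (Y 0 \<omega>)"
          using elim Suc.prems by (simp add: ln_mult)
        then have "prob {\<omega>'\<in>space M. walk m \<omega>' \<le> ln (real (child n \<omega>))}
            \<le> prob {\<omega>'\<in>space M. walk m \<omega>' - ln (Y 0 \<omega>) \<in> {..ln (real n)}}"
          by (intro finite_measure_mono) auto
        with Suc.IH[of "child n \<omega>"] False show ?thesis by simp
      qed (simp add: tail_0)
    qed
  qed simp
  also have "\<dots> = prob {\<omega>\<in>space M. walk (Suc m) \<omega> \<in> {..ln (real n)}}"
    by (rule prob_walk_Suc[symmetric]) simp
  finally show ?case by simp
qed

text \<open>While the labels stay at least \<open>K\<close>, each step loses at most
  \<open>1 / K\<close> more than the walk does, hence the correction \<open>m / K\<close>. If the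
  child falls below \<open>K\<close>, the remaining threshold is negative and out of reach of a
  non-negative walk. For \<open>m = 0\<close> the left event is empty unless
  \<open>n > K\<close>.\<close>

lemma walk_le_tail:
  assumes "n > 0" and K: "K > 0"
  shows "prob {\<omega>\<in>space M. walk m \<omega> < ln (real n) - ln (real K) - real m / real K} \<le> tail m n"
  using assms(1)
proof (induction m arbitrary: n)
  case 0
  show ?case
  proof (cases "K < n")
    case True
    then have "{\<omega>\<in>space M. 0 < depth n \<omega>} = space M"
      unfolding depth_def using range by (subst sarrt_depth_rec) auto
    then show ?thesis by (simp add: tail_def prob_space)
  next
    case False
    then have "ln (real n) \<le> ln (real K)" using 0 K by simp
    then show ?thesis using tail_nonneg[of 0 n] by (simp add: walk_def)
  qed
next
  case (Suc m)
  let ?t = "ln (real n) - ln (real K) - real (Suc m) / real K"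
  have "prob {\<omega>\<in>space M. walk (Suc m) \<omega> < ?t} = prob {\<omega>\<in>space M. walk (Suc m) \<omega> \<in> {..<?t}}"
    by simp
  also have "\<dots> = expectation (\<lambda>\<omega>. prob {\<omega>'\<in>space M. walk m \<omega>' - ln (Y 0 \<omega>) \<in> {..<?t}})"
    by (rule prob_walk_Suc) simp
  also have "\<dots> \<le> expectation (\<lambda>\<omega>. tail m (child n \<omega>))"
  proof (intro integral_mono_AE integrable_tail integrable_prob_walk)
    show "AE \<omega> in M. prob {\<omega>'\<in>space M. walk m \<omega>' - ln (Y 0 \<omega>) \<in> {..<?t}} \<le> tail m (child n \<omega>)"
      using AE_Y_pos
    proof eventually_elim
      case (elim \<omega>)
      have Suc_div: "real (Suc m) / real K = real m / real K + 1 / real K"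
        by (simp add: add_divide_distrib)
      show ?case
      proof (cases "K \<le> child n \<omega>")
        case True
        have "prob {\<omega>'\<in>space M. walk m \<omega>' - ln (Y 0 \<omega>) \<in> {..<?t}}
          \<le> prob {\<omega>'\<in>space M. walk m \<omega>' < ln (real (child n \<omega>)) - ln (real K) - real m / real K}"
          using ln_child_ge[OF K True] Suc_div by (intro finite_measure_mono) auto
        also have "\<dots> \<le> tail m (child n \<omega>)" using True K by (intro Suc.IH) simp
        finally show ?thesis .
      next
        case False
        then have "ln (real n) + ln (Y 0 \<omega>) < ln (real K)"
          using elim Suc.prems by (intro ln_child_less) auto
        moreover have "real (Suc m) / real K \<ge> 0" by simp
        ultimately have "?t + ln (Y 0 \<omega>) < 0" by linarith
        then have "\<not> walk m \<omega>' - ln (Y 0 \<omega>) < ?t" for \<omega>'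
          using walk_nonneg[of m \<omega>'] by linarith
        then have "{\<omega>'\<in>space M. walk m \<omega>' - ln (Y 0 \<omega>) \<in> {..<?t}} = {}"
          by (simp only: lessThan_iff) simp
        then show ?thesis using tail_nonneg by (simp only: measure_empty)
      qed
    qed
  qed simp
  also have "\<dots> = tail (Suc m) n" using Suc.prems by (rule tail_Suc[symmetric])
  finally show ?case .
qed

text \<open>Zero variance makes every increment equal to \<open>mean\<close>, so the walk is
  deterministic and both comparison bounds become probabilities \<open>0\<close> or
  \<open>1\<close>. This traps the depth in a deterministic window around \<open>ln n / mean\<close>
  of width of order \<open>ln (ln n)\<close>.\<close>

lemma depth_degenerate:
  assumes zero: "neg_log_variance M (Y 0) = 0"
  shows "AE \<omega> in M. (\<lambda>n. real (depth n \<omega>) - ln (real n) / mean) \<in> o(\<lambda>n. sqrt (ln (real n)))"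
proof -
  have "neg_log_mean M (Y 0) \<noteq> \<infinity>" using finite_mean by simp
  then have "(\<integral>\<^sup>+ \<omega>. ennreal ((- ln (Y 0 \<omega>) - mean)\<^sup>2) \<partial>M) = 0"
    using zero by (simp add: neg_log_variance_def mean_eq)
  then have "AE \<omega> in M. ennreal ((- ln (Y 0 \<omega>) - mean)\<^sup>2) = 0"
    by (subst (asm) nn_integral_0_iff_AE) auto
  then have "AE \<omega> in M. - ln (Y 0 \<omega>) = mean"
    by eventually_elim simp
  then have "AE y in distr M borel (Y 0). - ln y = mean"
    by (subst AE_distr_iff) auto
  then have "AE \<omega> in M. - ln (Y i \<omega>) = mean" for i
    by (subst (asm) ident[of i, symmetric], subst (asm) AE_distr_iff) auto
  then have "AE \<omega> in M. \<forall>i. - ln (Y i \<omega>) = mean"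
    by (simp add: AE_all_countable)
  then have walk: "AE \<omega> in M. \<forall>m. walk m \<omega> = real m * mean"
    by eventually_elim (simp add: walk_def flip: sum_negf)
  have above: "AE \<omega> in M. \<not> m < depth n \<omega>" if "n > 0" "ln (real n) < real m * mean" for m n
  proof -
    have "prob {\<omega>\<in>space M. walk m \<omega> \<le> ln (real n)} = 0"
      using walk that by (subst prob_eq_0) (auto elim!: eventually_mono)
    then have "prob {\<omega>\<in>space M. m < depth n \<omega>} = 0"
      using tail_le_walk[OF that(1), of m] tail_nonneg[of m n] by (simp add: tail_def measure_le_0_iff)
    then show ?thesis by (subst (asm) prob_eq_0) auto
  qed
  have below: "AE \<omega> in M. m < depth n \<omega>"
    if "n > 0" "K > 0" "real m * mean < ln (real n) - ln (real K) - real m / real K" for m n K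
  proof -
    have "prob {\<omega>\<in>space M. walk m \<omega> < ln (real n) - ln (real K) - real m / real K} = 1"
      using walk that by (subst prob_eq_1) (auto elim!: eventually_mono)
    then have "prob {\<omega>\<in>space M. m < depth n \<omega>} = 1"
      using walk_le_tail[OF that(1,2), of m] tail_le_1[of m n] by (simp add: tail_def measure_ge_1_iff)
    then show ?thesis by (subst (asm) prob_eq_1) auto
  qed
  \<comment> \<open>Only countably many triples of integers occur, so a single null set serves all
    of them.\<close>
  have "AE \<omega> in M. \<forall>m n. n > 0 \<longrightarrow> ln (real n) < real m * mean \<longrightarrow> \<not> m < depth n \<omega>"
    using above by (simp add: AE_all_countable)
  moreover have "AE \<omega> in M. \<forall>m n K. n > 0 \<longrightarrow> K > 0 \<longrightarrow>
      real m * mean < ln (real n) - ln (real K) - real m / real K \<longrightarrow> m < depth n \<omega>"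
    using below by (simp add: AE_all_countable)
  ultimately show ?thesis
  proof eventually_elim
    case (elim \<omega>)
    let ?l = "\<lambda>n. ln (real n)"
    have upper: "real (depth n \<omega>) \<le> ?l n / mean + 1" if n: "n > 0" for n
    proof (cases "depth n \<omega>")
      case (Suc m)
      then have "real m * mean \<le> ?l n" using elim(1) n by (metis lessI linorder_not_less)
      then show ?thesis using Suc mean_pos by (simp add: field_simps)
    qed (use n mean_pos in simp)
    have lower: "?l n / mean - (ln (?l n + 1) + (1 / mean + 1)) / mean \<le> real (depth n \<omega>)" if n: "n > 3" for n
    proof -
      define d where "d = real (depth n \<omega>)"
      \<comment> \<open>This \<open>K\<close> balances the two errors: \<open>ln K\<close> is about
        \<open>ln (ln n)\<close>, and \<open>d / K\<close> stays bounded because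
        \<open>upper\<close> makes \<open>d\<close> of order \<open>ln n\<close>.\<close>
      define K where "K = nat \<lceil>?l n\<rceil>"
      have l: "1 < ?l n"
      proof -
        have "exp 1 < real n" using exp_le n by (meson le_less_trans numeral_less_real_of_nat_iff)
        then show ?thesis using n by (subst ln_exp[of 1, symmetric], subst ln_less_cancel_iff) auto
      qed
      have K: "?l n \<le> real K" "real K \<le> ?l n + 1" "K > 0"
        using l unfolding K_def by (auto simp: real_nat_ceiling_ge)
      have "?l n - ln (real K) - d / real K \<le> d * mean"
        using elim(2) n K(3) unfolding d_def by (metis less_irrefl linorder_not_less gr_implies_not0 not_gr0)
      moreover have "ln (real K) \<le> ln (?l n + 1)" using K l by (subst ln_le_cancel_iff) auto
      moreover have "d / real K \<le> 1 / mean + 1"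
      proof -
        have "d \<le> ?l n / mean + 1" using upper[of n] n by (simp add: d_def)
        also have "\<dots> \<le> real K / mean + real K"
          using K l mean_pos by (intro add_mono divide_right_mono) auto
        finally show ?thesis using K(3) by (simp add: field_simps)
      qed
      ultimately have "?l n - (ln (?l n + 1) + (1 / mean + 1)) \<le> d * mean" by linarith
      then have "(?l n - (ln (?l n + 1) + (1 / mean + 1))) / mean \<le> d"
        using mean_pos by (simp add: pos_divide_le_eq)
      then show ?thesis by (simp add: d_def diff_divide_distrib)
    qed
    define c where "c = mean"
    have "c > 0" using mean_pos by (simp add: c_def)
    have "(\<lambda>n. real (depth n \<omega>) - ?l n / mean) \<in> O(\<lambda>n. (ln (?l n + 1) + (1 / c + 1)) / c + 1)"
    proof (rule landau_o.bigI[of 1])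
      show "\<forall>\<^sub>F n in sequentially. norm (real (depth n \<omega>) - ?l n / mean)
          \<le> 1 * norm ((ln (?l n + 1) + (1 / c + 1)) / c + 1)"
        using eventually_gt_at_top[of 3]
      proof eventually_elim
        case (elim n)
        have "ln (?l n + 1) \<ge> 0" using elim by simp
        then have "(ln (?l n + 1) + (1 / mean + 1)) / mean \<ge> 0"
          using mean_pos by simp
        then show ?case using upper[of n] lower[of n] elim by (simp add: c_def abs_le_iff)
      qed
    qed simp
    also have "(\<lambda>n. (ln (?l n + 1) + (1 / c + 1)) / c + 1) \<in> o(\<lambda>n. sqrt (?l n))"
      using \<open>c > 0\<close> by real_asymp
    finally show ?case .
  qed
qed

end

section \<open>The central limit theorem\<close>

text \<open>Monotonicity squeezes the value at the moving argument between values at two fixed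
  arguments near \<open>x\<close>, where pointwise convergence applies; continuity of
  \<open>F\<close> closes the gap.\<close>

lemma tendsto_mono_pointwise:
  fixes G :: "nat \<Rightarrow> real \<Rightarrow> real"
  assumes mono: "\<And>k. mono (G k)" and lim: "\<And>y. (\<lambda>k. G k y) \<longlonglongrightarrow> F y"
    and F: "isCont F x" and k: "filterlim k at_top sequentially" and y: "y \<longlonglongrightarrow> x"
  shows "(\<lambda>n. G (k n) (y n)) \<longlonglongrightarrow> F x"
proof (rule tendstoI)
  fix e :: real assume e: "e > 0"
  obtain d where d: "d > 0" "\<And>z. dist z x < d \<Longrightarrow> dist (F z) (F x) < e / 2"
    using F e unfolding continuous_at_eps_delta by (meson half_gt_zero)
  have lim': "\<forall>\<^sub>F n in sequentially. dist (G (k n) z) (F z) < e / 2" for z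
    using tendstoD[OF filterlim_compose[OF lim k], of "e / 2" z] e by simp
  have "\<forall>\<^sub>F n in sequentially. dist (y n) x < d / 2"
    using tendstoD[OF y, of "d / 2"] d(1) by simp
  then show "\<forall>\<^sub>F n in sequentially. dist (G (k n) (y n)) (F x) < e"
    using lim'[of "x - d / 2"] lim'[of "x + d / 2"]
  proof eventually_elim
    case (elim n)
    have "x - d / 2 \<le> y n" "y n \<le> x + d / 2"
      using elim(1) unfolding dist_real_def by linarith+
    then have "G (k n) (x - d / 2) \<le> G (k n) (y n)" "G (k n) (y n) \<le> G (k n) (x + d / 2)"
      by (simp_all add: monoD[OF mono])
    moreover have "dist (F (x - d / 2)) (F x) < e / 2" "dist (F (x + d / 2)) (F x) < e / 2"
      using d(1) by (intro d(2); simp add: dist_real_def)+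
    ultimately show ?case using elim(2,3) unfolding dist_real_def by linarith
  qed
qed

text \<open>A distribution function is continuous where there is no atom, and a law with a density
  has none.\<close>

lemma isCont_cdf_std_normal: "isCont (cdf std_normal_distribution) x"
proof -
  interpret real_distribution std_normal_distribution by (rule real_dist_normal_dist)
  have "AE y in lborel. ennreal (std_normal_density y) * indicator {x} y = 0"
    using AE_lborel_singleton[of x] by eventually_elim simp
  then have "emeasure std_normal_distribution {x} = 0"
    by (subst emeasure_density) (auto simp: nn_integral_0_iff_AE simp del: mult_eq_0_iff)
  then show ?thesis by (simp add: isCont_cdf measure_def)
qed

text \<open>Here \<open>m\<close> is a rounded quantile of the depth, and \<open>m * c - l\<close>
  equals \<open>x * s * sqrt (l / c)\<close> up to a bounded term. Since \<open>m\<close> is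
  asymptotic to \<open>l / c\<close>, dividing by \<open>sqrt (m * s\<^sup>2)\<close> leaves
  \<open>x\<close>; this explains the cube of \<open>c\<close>. The sequence \<open>e\<close>
  carries the comparison errors.\<close>

lemma normalization_tendsto:
  fixes c s x :: real and l m e :: "nat \<Rightarrow> real"
  assumes c: "c > 0" and s: "s > 0" and l: "filterlim l at_top sequentially"
    and m: "\<And>n. m n \<le> l n / c + x * (s * sqrt (l n / c ^ 3))"
      "\<And>n. l n / c + x * (s * sqrt (l n / c ^ 3)) - 1 \<le> m n"
    and e: "(\<lambda>n. e n / sqrt (l n)) \<longlonglongrightarrow> 0"
  shows "(\<lambda>n. m n / l n) \<longlonglongrightarrow> 1 / c"
    and "(\<lambda>n. (m n * c - l n + e n) / sqrt (m n * s\<^sup>2)) \<longlonglongrightarrow> x"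
proof -
  define r where "r n = m n - (l n / c + x * (s * sqrt (l n / c ^ 3)))" for n
  have r: "\<bar>r n\<bar> \<le> 1" for n using m[of n] by (simp add: r_def)
  have m_eq: "m n = l n / c + x * (s * sqrt (l n / c ^ 3)) + r n" for n by (simp add: r_def)
  have pos: "\<forall>\<^sub>F n in sequentially. l n > 0"
    using l by (simp add: filterlim_at_top_dense)
  have inv_l: "(\<lambda>n. 1 / l n) \<longlonglongrightarrow> 0"
    using l by (intro tendsto_divide_0[OF tendsto_const] filterlim_at_top_imp_at_infinity)
  have "filterlim (\<lambda>n. sqrt (l n)) at_top sequentially"
    by (rule filterlim_compose[OF sqrt_at_top l])
  then have inv_sqrt: "(\<lambda>n. 1 / sqrt (l n)) \<longlonglongrightarrow> 0"
    by (intro tendsto_divide_0[OF tendsto_const] filterlim_at_top_imp_at_infinity)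
  have bounded_null: "(\<lambda>n. r n * u n) \<longlonglongrightarrow> 0" if "u \<longlonglongrightarrow> 0" for u
    by (rule Lim_null_comparison[OF _ tendsto_rabs_zero[OF that]])
       (use r in \<open>simp add: abs_mult mult_left_le_one_le\<close>)
  note r_l = bounded_null[OF inv_l] and r_sqrt = bounded_null[OF inv_sqrt]
  have "(\<lambda>n. 1 / c + x * s / sqrt (c ^ 3) * (1 / sqrt (l n)) + r n * (1 / l n)) \<longlonglongrightarrow> 1 / c + x * s / sqrt (c ^ 3) * 0 + 0"
    by (intro tendsto_intros inv_sqrt r_l)
  moreover have "\<forall>\<^sub>F n in sequentially.
      1 / c + x * s / sqrt (c ^ 3) * (1 / sqrt (l n)) + r n * (1 / l n) = m n / l n"
    using pos
  proof eventually_elim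
    case (elim n)
    then have "sqrt (l n) / l n = 1 / sqrt (l n)" by (simp add: field_simps)
    then show ?case using elim c unfolding m_eq
      by (simp add: add_divide_distrib real_sqrt_divide) (simp add: field_simps)
  qed
  ultimately show ml: "(\<lambda>n. m n / l n) \<longlonglongrightarrow> 1 / c"
    using Lim_transform_eventually by fastforce
  have "(\<lambda>n. (x * s * c / sqrt (c ^ 3) + c * (r n * (1 / sqrt (l n))) + e n / sqrt (l n)) / (s * sqrt (m n / l n)))
      \<longlonglongrightarrow> (x * s * c / sqrt (c ^ 3) + c * 0 + 0) / (s * sqrt (1 / c))"
    using s c by (intro tendsto_intros r_sqrt e ml) auto
  moreover have "(x * s * c / sqrt (c ^ 3) + c * 0 + 0) / (s * sqrt (1 / c)) = x"
  proof -
    have "sqrt (c ^ 3) = c * sqrt c" using c by (simp add: power3_eq_cube real_sqrt_mult)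
    then show ?thesis using s c by (simp add: real_sqrt_divide)
  qed
  moreover have "\<forall>\<^sub>F n in sequentially.
      (x * s * c / sqrt (c ^ 3) + c * (r n * (1 / sqrt (l n))) + e n / sqrt (l n)) / (s * sqrt (m n / l n))
      = (m n * c - l n + e n) / sqrt (m n * s\<^sup>2)"
    using pos
  proof eventually_elim
    case (elim n)
    have "m n * c - l n = sqrt (l n) * (x * s * c / sqrt (c ^ 3)) + c * r n"
      using c by (simp add: m_eq real_sqrt_divide algebra_simps)
    then have "x * s * c / sqrt (c ^ 3) + c * (r n * (1 / sqrt (l n))) + e n / sqrt (l n)
      = (m n * c - l n + e n) / sqrt (l n)"
      using elim by (simp add: field_simps)
    then show ?case using elim s
      by (simp add: real_sqrt_divide real_sqrt_mult mult.commute)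
  qed
  ultimately show "(\<lambda>n. (m n * c - l n + e n) / sqrt (m n * s\<^sup>2)) \<longlonglongrightarrow> x"
    using Lim_transform_eventually by fastforce
qed

context sarrt_finite_mean
begin

text \<open>The sign is reversed because a small depth corresponds to a large walk: the centred
  summands are \<open>mean + ln (Y i)\<close>, and the limit law is symmetric.\<close>

lemma walk_central_limit:
  assumes V: "0 < neg_log_variance M (Y 0)" "neg_log_variance M (Y 0) < \<infinity>"
  defines "s \<equiv> sqrt (enn2real (neg_log_variance M (Y 0)))"
  shows "(\<lambda>m. prob {\<omega>\<in>space M. (real m * mean - walk m \<omega>) / sqrt (real m * s\<^sup>2) \<le> x})
    \<longlonglongrightarrow> cdf std_normal_distribution x"
proof -
  define X where "X i \<omega> = mean + ln (Y i \<omega>)" for i \<omega>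
  have [measurable]: "X i \<in> borel_measurable M" for i unfolding X_def[abs_def] by measurable
  have V_eq: "neg_log_variance M (Y 0) = (\<integral>\<^sup>+ \<omega>. ennreal ((X 0 \<omega>)\<^sup>2) \<partial>M)"
    using finite_mean unfolding neg_log_variance_def X_def mean_eq[symmetric]
    by (auto intro!: nn_integral_cong simp: power2_eq_square algebra_simps)
  have int0: "integrable M (\<lambda>\<omega>. (X 0 \<omega>)\<^sup>2)"
    using V(2) by (intro integrableI_nonneg) (auto simp: V_eq)
  have s2: "s\<^sup>2 = expectation (\<lambda>\<omega>. (X 0 \<omega>)\<^sup>2)"
    by (simp add: s_def V_eq integral_eq_nn_integral)
  have s_pos: "s > 0" using V by (simp add: s_def enn2real_positive_iff)
  have distr_X: "distr M borel (X i) = distr (distr M borel (Y i)) borel (\<lambda>y. mean + ln y)" for i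
    by (subst distr_distr) (auto simp: X_def[abs_def] comp_def)
  then have distr_eq: "distr M borel (X i) = distr M borel (X 0)" for i
    by (simp only: ident[of i])
  have transfer: "expectation (\<lambda>\<omega>. f (X i \<omega>)) = expectation (\<lambda>\<omega>. f (X 0 \<omega>))"
    if [measurable]: "f \<in> borel_measurable borel" for f :: "real \<Rightarrow> real" and i
    unfolding X_def using expectation_Y_eq[of "\<lambda>y. f (mean + ln y)" i] by simp
  have mean_0: "expectation (X i) = 0" for i
  proof -
    have "expectation (X 0) = 0"
      using integrable_ln by (simp add: X_def[abs_def] prob_space mean_def)
    then show ?thesis using transfer[of "\<lambda>x. x" i] by simp
  qed
  have clt: "weak_conv_m (\<lambda>n. distr M borel (\<lambda>\<omega>. (\<Sum>i<n. X i \<omega>) / sqrt (real n * s\<^sup>2))) std_normal_distribution"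
  proof (rule central_limit_theorem_zero_mean[OF _ mean_0 s_pos])
    show "indep_vars (\<lambda>_. borel) X UNIV"
      unfolding X_def[abs_def] by (rule indep_vars_compose2[OF indep]) measurable
    show "integrable M (\<lambda>\<omega>. (X i \<omega>)\<^sup>2)" for i
    proof -
      have "integrable (distr M borel (X 0)) (\<lambda>x. x\<^sup>2)"
        using int0 by (subst integrable_distr_eq) auto
      then have "integrable (distr M borel (X i)) (\<lambda>x. x\<^sup>2)" by (simp only: distr_eq[of i])
      then show ?thesis by (subst (asm) integrable_distr_eq) auto
    qed
    show "variance (X i) = s\<^sup>2" for i
      using transfer[of power2 i] by (simp add: mean_0 s2)
    show "distr M borel (X i) = distr M borel (X 0)" for i by (rule distr_eq)
  qed
  have sum_eq: "(\<Sum>i<n. X i \<omega>) = real n * mean - walk n \<omega>" for n \<omega>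
    by (simp add: X_def walk_def sum.distrib sum_negf)
  have cdf_eq: "cdf (distr M borel (\<lambda>\<omega>. (real n * mean - walk n \<omega>) / sqrt (real n * s\<^sup>2))) x
      = prob {\<omega>\<in>space M. (real n * mean - walk n \<omega>) / sqrt (real n * s\<^sup>2) \<le> x}" for n
    by (auto simp: cdf_def measure_distr intro!: arg_cong[where f = prob])
  have "(\<lambda>n. cdf (distr M borel (\<lambda>\<omega>. (real n * mean - walk n \<omega>) / sqrt (real n * s\<^sup>2))) x)
      \<longlonglongrightarrow> cdf std_normal_distribution x"
    using clt isCont_cdf_std_normal[of x] unfolding weak_conv_m_def weak_conv_def sum_eq by blast
  then show ?thesis by (simp only: cdf_eq)
qed

text \<open>The distribution function at \<open>x\<close> is \<open>1 - tail (m n) n\<close>, which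
  the two walk comparisons enclose between values of \<open>G\<close> whose arguments both tend to
  \<open>x\<close>.\<close>

lemma depth_central_limit:
  assumes V: "0 < neg_log_variance M (Y 0)" "neg_log_variance M (Y 0) < \<infinity>"
  defines "s \<equiv> sqrt (enn2real (neg_log_variance M (Y 0)))"
  shows "weak_conv_m (\<lambda>n. distr M borel
      (\<lambda>\<omega>. (real (depth n \<omega>) - ln (real n) / mean) / (s * sqrt (ln (real n) / mean ^ 3))))
    std_normal_distribution"
  unfolding weak_conv_m_def weak_conv_def
proof (intro allI impI)
  fix x
  have s_pos: "s > 0" using V by (simp add: s_def enn2real_positive_iff)
  let ?l = "\<lambda>n. ln (real n)"
  define y where "y n = ?l n / mean + x * (s * sqrt (?l n / mean ^ 3))" for n
  \<comment> \<open>As the depth is an integer, being at most \<open>y n\<close> is the same as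
    being at most \<open>m n\<close> once \<open>y n\<close> is non-negative.\<close>
  define m where "m n = nat \<lfloor>y n\<rfloor>" for n
  define K where "K n = nat \<lceil>?l n\<rceil>" for n
  define G where "G k z = prob {\<omega>\<in>space M. (real k * mean - walk k \<omega>) / sqrt (real k * s\<^sup>2) \<le> z}" for k z
  have l_top: "filterlim ?l at_top sequentially" by real_asymp
  have y_top: "filterlim y at_top sequentially"
  proof -
    define c where "c = mean"
    have "c > 0" using mean_pos by (simp add: c_def)
    have "filterlim (\<lambda>t. t / c + x * (s * sqrt (t / c ^ 3))) at_top at_top"
      using \<open>c > 0\<close> s_pos by (cases x "0 :: real" rule: linorder_cases) real_asymp+
    from filterlim_compose[OF this l_top] show ?thesis by (simp add: y_def[abs_def] c_def)
  qed
  have m_real: "real (m n) = real_of_int \<lfloor>y n\<rfloor>" if "y n \<ge> 0" for n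
    using that by (simp add: m_def)
  have y_pos: "\<forall>\<^sub>F n in sequentially. y n \<ge> 1"
    using y_top by (simp add: filterlim_at_top)
  have m_top: "filterlim m at_top sequentially"
    unfolding m_def by (rule filterlim_compose[OF filterlim_nat_sequentially filterlim_compose[OF filterlim_floor_sequentially y_top]])
  have norm: "(\<lambda>n. m n / ?l n) \<longlonglongrightarrow> 1 / mean"
      "(\<lambda>n. (real (m n) * mean - ?l n + e n) / sqrt (real (m n) * s\<^sup>2)) \<longlonglongrightarrow> x"
    if e: "(\<lambda>n. e n / sqrt (?l n)) \<longlonglongrightarrow> 0" for e
  proof -
    \<comment> \<open>The rounding bounds are required for every \<open>n\<close> and hold for the
      integer floor, which agrees with \<open>m n\<close> as soon as
      \<open>y n >= 1\<close>.\<close>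
    have ev: "\<forall>\<^sub>F n in sequentially. real_of_int \<lfloor>y n\<rfloor> = real (m n)"
      using y_pos by eventually_elim (simp add: m_real)
    have "real_of_int \<lfloor>y n\<rfloor> \<le> ?l n / mean + x * (s * sqrt (?l n / mean ^ 3))"
      "?l n / mean + x * (s * sqrt (?l n / mean ^ 3)) - 1 \<le> real_of_int \<lfloor>y n\<rfloor>" for n
      unfolding y_def by linarith+
    note lim = normalization_tendsto[OF mean_pos s_pos l_top this e]
    show "(\<lambda>n. m n / ?l n) \<longlonglongrightarrow> 1 / mean"
      by (rule Lim_transform_eventually[OF lim(1)]) (use ev in \<open>eventually_elim, simp\<close>)
    show "(\<lambda>n. (real (m n) * mean - ?l n + e n) / sqrt (real (m n) * s\<^sup>2)) \<longlonglongrightarrow> x"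
      by (rule Lim_transform_eventually[OF lim(2)]) (use ev in \<open>eventually_elim, simp\<close>)
  qed
  have lim: "(\<lambda>n. G (m n) ((real (m n) * mean - ?l n + e n) / sqrt (real (m n) * s\<^sup>2)))
      \<longlonglongrightarrow> cdf std_normal_distribution x" if e: "(\<lambda>n. e n / sqrt (?l n)) \<longlonglongrightarrow> 0" for e
  proof (rule tendsto_mono_pointwise[OF _ _ isCont_cdf_std_normal m_top norm(2)[OF e]])
    show "mono (G k)" for k
      unfolding G_def by (intro monoI finite_measure_mono) auto
    show "(\<lambda>k. G k z) \<longlonglongrightarrow> cdf std_normal_distribution z" for z
      unfolding G_def s_def by (rule walk_central_limit[OF V])
  qed
  have K: "\<forall>\<^sub>F n in sequentially. ?l n > 0 \<and> ?l n \<le> real (K n) \<and> real (K n) \<le> ?l n + 1 \<and> K n > 0"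
    using eventually_gt_at_top[of 1]
  proof eventually_elim
    case (elim n)
    then have "?l n > 0" by simp
    then show ?case unfolding K_def by (auto simp: real_nat_ceiling_ge)
  qed
  \<comment> \<open>The shift by \<open>1\<close> passes from the closed event in \<open>G\<close>
    to the strict event \<open>walk (m n) > ln n\<close>; it vanishes after scaling.\<close>
  have e_lower: "(\<lambda>n. - 1 / sqrt (?l n)) \<longlonglongrightarrow> 0" by real_asymp
  \<comment> \<open>Since \<open>K n >= ln n\<close> and \<open>m n\<close> is of order
    \<open>ln n\<close>, the second term is bounded, while the first is at most
    \<open>ln (ln n + 1)\<close>.\<close>
  have e_upper: "(\<lambda>n. (ln (real (K n)) + real (m n) / real (K n)) / sqrt (?l n)) \<longlonglongrightarrow> 0"
  proof (rule tendsto_sandwich[OF _ _ tendsto_const])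
    have "(\<lambda>n. ln (?l n + 1) / sqrt (?l n) + real (m n) / ?l n * (1 / sqrt (?l n))) \<longlonglongrightarrow> 0 + 1 / mean * 0"
      by (intro tendsto_add tendsto_mult norm(1)[OF e_lower]; real_asymp)
    then show "(\<lambda>n. ln (?l n + 1) / sqrt (?l n) + real (m n) / ?l n * (1 / sqrt (?l n))) \<longlonglongrightarrow> 0" by simp
    show "\<forall>\<^sub>F n in sequentially. 0 \<le> (ln (real (K n)) + real (m n) / real (K n)) / sqrt (?l n)"
      using K by eventually_elim auto
    show "\<forall>\<^sub>F n in sequentially. (ln (real (K n)) + real (m n) / real (K n)) / sqrt (?l n)
        \<le> ln (?l n + 1) / sqrt (?l n) + real (m n) / ?l n * (1 / sqrt (?l n))"
      using K
    proof eventually_elim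
      case (elim n)
      have "ln (real (K n)) + real (m n) / real (K n) \<le> ln (?l n + 1) + real (m n) / ?l n"
        using elim by (intro add_mono divide_left_mono) (auto intro!: mult_pos_pos)
      then have "(ln (real (K n)) + real (m n) / real (K n)) / sqrt (?l n)
          \<le> (ln (?l n + 1) + real (m n) / ?l n) / sqrt (?l n)"
        using elim by (intro divide_right_mono) auto
      then show ?case by (simp add: add_divide_distrib)
    qed
  qed
  have m_pos: "\<forall>\<^sub>F n in sequentially. m n > 0"
    by (rule eventually_compose_filterlim[OF eventually_gt_at_top[of 0] m_top])
  have cdf_eq: "\<forall>\<^sub>F n in sequentially. cdf (distr M borel
      (\<lambda>\<omega>. (real (depth n \<omega>) - ?l n / mean) / (s * sqrt (?l n / mean ^ 3)))) x = 1 - tail (m n) n"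
    using y_pos K
  proof eventually_elim
    case (elim n)
    have "s * sqrt (?l n / mean ^ 3) > 0" using elim s_pos mean_pos by simp
    then have *: "(real (depth n \<omega>) - ?l n / mean) / (s * sqrt (?l n / mean ^ 3)) \<le> x \<longleftrightarrow> \<not> m n < depth n \<omega>" for \<omega>
    proof -
      have "(real (depth n \<omega>) - ?l n / mean) / (s * sqrt (?l n / mean ^ 3)) \<le> x \<longleftrightarrow> real (depth n \<omega>) \<le> y n"
        using \<open>s * sqrt (?l n / mean ^ 3) > 0\<close> by (subst pos_divide_le_eq) (auto simp: y_def)
      also have "\<dots> \<longleftrightarrow> depth n \<omega> \<le> m n" using elim unfolding m_def by (simp add: le_nat_iff le_floor_iff)
      finally show ?thesis by auto
    qed
    have "cdf (distr M borel (\<lambda>\<omega>. (real (depth n \<omega>) - ?l n / mean) / (s * sqrt (?l n / mean ^ 3)))) x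
      = prob {\<omega>\<in>space M. (real (depth n \<omega>) - ?l n / mean) / (s * sqrt (?l n / mean ^ 3)) \<le> x}"
      by (auto simp: cdf_def measure_distr intro!: arg_cong[where f = prob])
    also have "\<dots> = prob {\<omega>\<in>space M. \<not> m n < depth n \<omega>}" by (simp only: *)
    also have "\<dots> = 1 - tail (m n) n" unfolding tail_def by (rule prob_neg) measurable
    finally show ?case .
  qed
  show "(\<lambda>n. cdf (distr M borel
      (\<lambda>\<omega>. (real (depth n \<omega>) - ?l n / mean) / (s * sqrt (?l n / mean ^ 3)))) x) \<longlonglongrightarrow> cdf std_normal_distribution x"
  proof (rule tendsto_sandwich[OF _ _ lim[OF e_lower] lim[OF e_upper]])
    show "\<forall>\<^sub>F n in sequentially. G (m n) ((real (m n) * mean - ?l n + - 1) / sqrt (real (m n) * s\<^sup>2))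
      \<le> cdf (distr M borel (\<lambda>\<omega>. (real (depth n \<omega>) - ?l n / mean) / (s * sqrt (?l n / mean ^ 3)))) x"
      using cdf_eq m_pos eventually_gt_at_top[of 0]
    proof eventually_elim
      case (elim n)
      have "sqrt (real (m n) * s\<^sup>2) > 0" using elim s_pos by simp
      then have "G (m n) ((real (m n) * mean - ?l n + - 1) / sqrt (real (m n) * s\<^sup>2))
          \<le> prob {\<omega>\<in>space M. \<not> walk (m n) \<omega> \<le> ?l n}"
        unfolding G_def by (intro finite_measure_mono) (auto simp: divide_le_cancel)
      also have "\<dots> = 1 - prob {\<omega>\<in>space M. walk (m n) \<omega> \<le> ?l n}" by (rule prob_neg) measurable
      also have "\<dots> \<le> 1 - tail (m n) n" using tail_le_walk[of n "m n"] elim by simp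
      finally show ?case using elim by simp
    qed
    show "\<forall>\<^sub>F n in sequentially. cdf (distr M borel (\<lambda>\<omega>. (real (depth n \<omega>) - ?l n / mean) / (s * sqrt (?l n / mean ^ 3)))) x
      \<le> G (m n) ((real (m n) * mean - ?l n + (ln (real (K n)) + real (m n) / real (K n))) / sqrt (real (m n) * s\<^sup>2))"
      using cdf_eq m_pos eventually_gt_at_top[of 0] K
    proof eventually_elim
      case (elim n)
      have pos: "sqrt (real (m n) * s\<^sup>2) > 0" using elim s_pos by simp
      have "1 - tail (m n) n \<le> 1 - prob {\<omega>\<in>space M. walk (m n) \<omega> < ?l n - ln (real (K n)) - real (m n) / real (K n)}"
        using walk_le_tail[of n "K n" "m n"] elim by simp
      also have "\<dots> = prob {\<omega>\<in>space M. \<not> walk (m n) \<omega> < ?l n - ln (real (K n)) - real (m n) / real (K n)}"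
        by (rule prob_neg[symmetric]) measurable
      also have "\<dots> \<le> G (m n) ((real (m n) * mean - ?l n + (ln (real (K n)) + real (m n) / real (K n))) / sqrt (real (m n) * s\<^sup>2))"
        unfolding G_def using pos by (intro finite_measure_mono) (auto simp: divide_le_cancel)
      finally show ?case using elim by simp
    qed
  qed
qed

end

section \<open>Transfer to the given variables and assembly of the four cases\<close>

theorem theorem1:
  fixes N :: "'b measure" and X :: "'b \<Rightarrow> real"
    and M :: "'a measure" and Xs :: "nat \<Rightarrow> 'a \<Rightarrow> real"
    and D :: "nat \<Rightarrow> 'a \<Rightarrow> real" and \<mu> \<sigma> :: real
  assumes N: "prob_space N"
    and X_rv: "X \<in> borel_measurable N"
    and X_range: "\<And>\<omega>. \<omega> \<in> space N \<Longrightarrow> X \<omega> \<in> {0..<1}"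
    and M: "prob_space M"
    and Xs_indep: "prob_space.indep_vars M (\<lambda>_. borel) Xs UNIV"
    and Xs_distr: "\<And>i. distr M borel (Xs i) = distr N borel X"
  defines "D n \<omega> \<equiv> real (sarrt_depth (\<lambda>i. Xs i \<omega>) n)"
    and "\<mu> \<equiv> enn2real (neg_log_mean N X)"
    and "\<sigma> \<equiv> sqrt (enn2real (neg_log_variance N X))"
  shows
    "(neg_log_mean N X = \<infinity> \<longrightarrow>
        tendsto_in_prob M (\<lambda>n \<omega>. D n \<omega> / ln (real n)) 0 \<and>
        (\<lambda>n. prob_space.expectation M (D n) / ln (real n)) \<longlonglongrightarrow> 0) \<and>
     (neg_log_mean N X < \<infinity> \<longrightarrow>
        tendsto_in_prob M (\<lambda>n \<omega>. D n \<omega> / ln (real n)) (1 / \<mu>) \<and>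
        (\<lambda>n. prob_space.expectation M (D n) / ln (real n)) \<longlonglongrightarrow> 1 / \<mu>) \<and>
     (neg_log_mean N X < \<infinity> \<and> 0 < neg_log_variance N X \<and> neg_log_variance N X < \<infinity> \<longrightarrow>
        weak_conv_m
          (\<lambda>n. distr M borel
             (\<lambda>\<omega>. (D n \<omega> - ln (real n) / \<mu>) / (\<sigma> * sqrt (ln (real n) / \<mu> ^ 3))))
          std_normal_distribution) \<and>
     (neg_log_mean N X < \<infinity> \<and> neg_log_variance N X = 0 \<longrightarrow>
        (AE \<omega> in M. (\<lambda>n. D n \<omega> - ln (real n) / \<mu>) \<in> o(\<lambda>n. sqrt (ln (real n)))))"
proof -
  interpret N: prob_space N by (rule N)
  interpret M: prob_space M by (rule M)
  note X_rv [measurable]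
  have Xs_rv [measurable]: "Xs i \<in> borel_measurable M" for i
    using Xs_indep by (auto simp: M.indep_vars_def)
  \<comment> \<open>The variables \<open>Xs i\<close> lie in \<open>[0, 1)\<close> only almost surely, the locale wants it everywhere.\<close>
  define clip :: "real \<Rightarrow> real" where "clip x = (if x \<in> {0..<1} then x else 0)" for x
  have [measurable]: "clip \<in> borel_measurable borel" unfolding clip_def[abs_def] by measurable
  define Y where "Y i \<omega> = clip (Xs i \<omega>)" for i \<omega>
  have [measurable]: "Y i \<in> borel_measurable M" for i unfolding Y_def[abs_def] by measurable
  have "AE x in distr N borel X. x \<in> {0..<1}"
    using X_range by (subst AE_distr_iff) auto
  then have "AE \<omega> in M. Xs i \<omega> \<in> {0..<1}" for i
    by (subst (asm) Xs_distr[of i, symmetric], subst (asm) AE_distr_iff) auto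
  then have "AE \<omega> in M. Y i \<omega> = Xs i \<omega>" for i
    by eventually_elim (auto simp: Y_def clip_def)
  then have Y_eq: "AE \<omega> in M. \<forall>i. Y i \<omega> = Xs i \<omega>"
    by (simp add: AE_all_countable)
  have distr_Y: "distr M borel (Y i) = distr N borel X" for i
    unfolding Xs_distr[of i, symmetric] using Y_eq
    by (intro distr_cong_AE) (auto elim!: eventually_mono)
  interpret sarrt M Y
  proof
    show "M.indep_vars (\<lambda>_. borel) Y UNIV"
      unfolding Y_def[abs_def] by (rule M.indep_vars_compose2[OF Xs_indep]) measurable
    show "Y i \<omega> \<in> {0..<1}" for i \<omega> by (simp add: Y_def clip_def)
    show "distr M borel (Y i) = distr M borel (Y 0)" for i by (simp only: distr_Y)
  qed
  \<comment> \<open>\<open>X\<close> and \<open>Y 0\<close> live on different probability spaces;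
    mean and variance pass between them through their common law.\<close>
  have nn: "(\<integral>\<^sup>+ \<omega>. f (X \<omega>) \<partial>N) = (\<integral>\<^sup>+ \<omega>. f (Y 0 \<omega>) \<partial>M)"
    if [measurable]: "f \<in> borel_measurable borel" for f :: "real \<Rightarrow> ennreal"
  proof -
    have "(\<integral>\<^sup>+ \<omega>. f (X \<omega>) \<partial>N) = (\<integral>\<^sup>+ x. f x \<partial>distr N borel X)" by (subst nn_integral_distr) auto
    also have "\<dots> = (\<integral>\<^sup>+ x. f x \<partial>distr M borel (Y 0))" by (simp only: distr_Y)
    also have "\<dots> = (\<integral>\<^sup>+ \<omega>. f (Y 0 \<omega>) \<partial>M)" by (subst nn_integral_distr) auto
    finally show ?thesis .
  qed
  have mean_NM: "neg_log_mean N X = neg_log_mean M (Y 0)"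
    unfolding neg_log_mean_def by (rule nn) (unfold neg_log_def[abs_def], measurable)
  have variance_NM: "neg_log_variance N X = neg_log_variance M (Y 0)"
    unfolding neg_log_variance_def mean_NM
    by (subst nn[of "\<lambda>x. ennreal ((- ln x - enn2real (neg_log_mean M (Y 0)))\<^sup>2)"]) auto
  have [measurable]: "D n \<in> borel_measurable M" for n
    using sarrt_depth_measurable[where X = Xs and k = n, OF Xs_rv] unfolding D_def[abs_def] by measurable
  \<comment> \<open>One null set works for all \<open>n\<close> at once, as the almost sure
    statement about the whole sequence requires.\<close>
  have D_eq: "AE \<omega> in M. \<forall>n. D n \<omega> = real (depth n \<omega>)"
    using Y_eq unfolding D_def depth_def by eventually_elim simp
  have expectation_D: "integral\<^sup>L M (D n) = integral\<^sup>L M (\<lambda>\<omega>. real (depth n \<omega>))" for n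
    using D_eq by (intro integral_cong_AE) (auto elim!: eventually_mono)
  have in_prob: "tendsto_in_prob M (\<lambda>n \<omega>. D n \<omega> / ln (real n)) a \<longleftrightarrow>
      tendsto_in_prob M (\<lambda>n \<omega>. real (depth n \<omega>) / ln (real n)) a" for a
  proof -
    have "measure M {\<omega> \<in> space M. e < \<bar>D n \<omega> / ln (real n) - a\<bar>} =
        measure M {\<omega> \<in> space M. e < \<bar>real (depth n \<omega>) / ln (real n) - a\<bar>}" for e n
      using D_eq by (intro measure_eq_AE) (auto elim!: eventually_mono)
    then show ?thesis unfolding tendsto_in_prob_def by (simp only:)
  qed
  have distr_D: "distr M borel (\<lambda>\<omega>. (D n \<omega> - u) / v) = distr M borel (\<lambda>\<omega>. (real (depth n \<omega>) - u) / v)" for n u v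
  proof (rule distr_cong_AE)
    show "AE \<omega> in M. (D n \<omega> - u) / v = (real (depth n \<omega>) - u) / v"
      using D_eq by eventually_elim simp
  qed auto
  show ?thesis
  proof (cases "neg_log_mean N X = \<infinity>")
    case True
    then show ?thesis
      using depth_L1_convergence_infinite_mean[unfolded mean_NM[symmetric], OF True]
        depth_tendsto_in_prob[of 0] expectation_depth_tendsto[of 0]
      by (simp add: in_prob expectation_D)
  next
    case False
    then interpret sarrt_finite_mean M Y
      by unfold_locales (simp add: mean_NM less_top)
    have \<mu>: "\<mu> = mean" by (simp add: \<mu>_def mean_NM mean_eq)
    have degenerate: "AE \<omega> in M. (\<lambda>n. D n \<omega> - ln (real n) / mean) \<in> o(\<lambda>n. sqrt (ln (real n)))"
      if "neg_log_variance M (Y 0) = 0"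
      using depth_degenerate[OF that] D_eq by eventually_elim simp
    show ?thesis
      using False depth_tendsto_in_prob[OF depth_L1_convergence_finite_mean]
        expectation_depth_tendsto[OF depth_L1_convergence_finite_mean]
        depth_central_limit degenerate
      by (simp add: in_prob expectation_D distr_D \<mu> \<sigma>_def variance_NM)
  qed
qed

end
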